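(* Assume that: (i) $K$ is a bounded nonnegative function on $\mathbb{R}^d$ with $\int_{\mathbb{R}^d}K(z)\,dz=1$, $\int_{\mathbb{R}^d}z_jK(z)\,dz=0$ for all $j\in\{1,\dots,d\}$, and $\int_{\mathbb{R}^d}\|z\|^2|K(z)|\,dz<\infty$; (ii) $K$ is Hölder-continuous on $\mathbb{R}^d$ and satisfies the covering number condition; (iii) $f$ is twice differentiable on $\mathbb{R}^d$, $\sup_{x\in\mathbb{R}^d}\|\nabla f(x)\|<\infty$ and $\sup_{x\in\mathbb{R}^d}\|D^2f(x)\|<\infty$. Let $C\subset\mathbb{R}^d$ be a compact set such that there exists $x\in C$ with $f(x)\neq 0$, and let $(\epsilon_n)$ be a sequence of positive real numbers. Assume that $$\epsilon_n\to 0,\quad \frac{h_n^*}{\epsilon_n}\to 0,\quad \frac{h_n^2}{\epsilon_n}\to 0,\quad v_n\epsilon_n^{3/2}\to\infty,\quad \frac{v_nh_n^{*2}}{\sqrt{\epsilon_n}}\to 0,\quad \frac{nh_n^{*d}}{v_n^2\log(1/h_n^* )}\to\infty,\quad \frac{v_n^2h_n^d\epsilon_n^2}{h_n^{*d}}\to\infty .$$ Let $\tilde T_n(x)=f_n(x)$ if $f_n(x)\geq\epsilon_n$ and $\tilde T_n(x)=\epsilon_n$ otherwise. Then, for any $\delta>0$, $$\lim_{n\to\infty}\frac{v_n^2}{nh_n^{*d}}\log\mathbb{P}\left(\exists x\in C,\ f(x)\notin\left[f_n^*(x)-\delta\frac{\sqrt{\tilde T_n(x)\kappa}}{v_n}\,;\,f_n^*(x)+\delta\frac{\sqrt{\tilde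 T_n(x)\kappa}}{v_n}\right]\right)=-\frac{\delta^2}{2}.$$ Moreover, the sequence of sets of functions $$D_n=\left\{g:\mathbb{R}^d\to\mathbb{R},\ |g(x)-f_n^*(x)|\leq\delta\frac{\sqrt{\tilde T_n(x)\kappa}}{v_n}\ \ \forall x\in C\right\}$$ is an asymptotic almost sure sequence of confidence regions of $f$.
   Context: Setting: $d\geq 1$ is an integer and $X_1,X_2,\dots$ are independent identically distributed $\mathbb{R}^d$-valued random vectors, defined on a probability space $(\Omega,\mathcal{A},\mathbb{P})$, with bounded probability density $f$. The kernel $K$ is a bounded nonnegative function on $\mathbb{R}^d$ with $\int K=1$ and $\lim_{\|z\|\to\infty}K(z)=0$. $(h_n)$ and $(h_n^* )$ are sequences of positive real numbers with $h_n\to 0$, $h_n^*\to 0$. $(v_n)$ is a positive nonrandom sequence with $v_n\to\infty$. The kernel density estimators are $$f_n(x)=\frac{1}{nh_n^d}\sum_{j=1}^nK\left(\frac{x-X_j}{h_n}\right),\qquad f_n^*(x)=\frac{1}{nh_n^{*d}}\sum_{j=1}^nK\left(\frac{x-X_j}{h_n^*}\right),$$ and $\kappa=\int_{\mathbb{R}^d}K^2(z)\,dz$. Covering number condition: for a probability $Q$ on $\mathbb{R}^d$ and a class $\mathcal{F}\subset\mathcal{L}_2(Q)$, the covering number $N_2(\epsilon,Q,\mathcal{F})$ is the smallest $m$ for which there exist $g_1,\dots,g_m\in\mathcal{L}_2(Q)$ with $\min_{1\leq i\leq m}\|g-g_i\|_{\mathcal{L}_2(Q)}\leq\epsilon$ for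 all $g\in\mathcal{F}$ ($N_2=\infty$ if no such $m$ exists). For a bounded integrable function $\Lambda$ on $\mathbb{R}^d$ let $\mathcal{F}(\Lambda)=\{z\mapsto\Lambda(\frac{x-z}{h}):\ h>0,\ x\in\mathbb{R}^d\}$. $\Lambda$ satisfies the covering number condition if there exist $A>0$ and $v>0$ such that, for any probability $Q$ on $\mathbb{R}^d$ and any $\epsilon\in(0,1)$, $N_2(\epsilon\|\Lambda\|_\infty,Q,\mathcal{F}(\Lambda))\leq(A/\epsilon)^v$. A sequence $(D_n)$ of (random) confidence regions of an unknown parameter $\theta$ is an asymptotic almost sure sequence of confidence regions of $\theta$ if there exists $\Omega_0\subset\Omega$ with $\mathbb{P}(\Omega_0)=1$ such that for every $\omega\in\Omega_0$ there is $N(\omega)$ such that $n\geq N(\omega)$ implies $\theta\in D_n(\omega)$. *)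

theory Defs
  imports "HOL-Probability.Probability"
begin

definition kde ::
  "(real^'d \<Rightarrow> real) \<Rightarrow> real \<Rightarrow> (nat \<Rightarrow> 'w \<Rightarrow> real^'d) \<Rightarrow> nat \<Rightarrow> 'w \<Rightarrow> real^'d \<Rightarrow> real"
where
  "kde K h X n \<omega> x = 1 / (real n * h ^ CARD('d)) * (\<Sum>j=1..n. K ((x - X j \<omega>) /\<^sub>R h))"

definition truncate_below :: "real \<Rightarrow> real \<Rightarrow> real" where
  "truncate_below e t = (if t \<ge> e then t else e)"

definition holder_continuous :: "('a::metric_space \<Rightarrow> 'b::metric_space) \<Rightarrow> bool" where
  "holder_continuous g \<longleftrightarrow>
     (\<exists>\<alpha> L. 0 < \<alpha> \<and> \<alpha> \<le> 1 \<and> (\<forall>x y. dist (g x) (g y) \<le> L * dist x y powr \<alpha>))"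

definition square_integrable :: "'a measure \<Rightarrow> ('a \<Rightarrow> real) \<Rightarrow> bool" where
  "square_integrable Q g \<longleftrightarrow> g \<in> borel_measurable Q \<and> integrable Q (\<lambda>z. (g z)\<^sup>2)"

definition L2_norm :: "'a measure \<Rightarrow> ('a \<Rightarrow> real) \<Rightarrow> real" where
  "L2_norm Q g = sqrt (\<integral>z. (g z)\<^sup>2 \<partial>Q)"

(* Only meaningful if all members of F are square integrable, as the Bochner integral in L2_norm
   is 0 for non-integrable functions.  The value is \<infinity> (the infimum of the empty set) if no
   finite cover exists. *)
definition covering_number :: "real \<Rightarrow> 'a measure \<Rightarrow> ('a \<Rightarrow> real) set \<Rightarrow> enat" where
  "covering_number \<epsilon> Q F =
     Inf {enat m | m. \<exists>g :: nat \<Rightarrow> 'a \<Rightarrow> real.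
       (\<forall>i\<in>{1..m}. square_integrable Q (g i)) \<and>
       (\<forall>\<phi>\<in>F. \<exists>i\<in>{1..m}. L2_norm Q (\<lambda>z. \<phi> z - g i z) \<le> \<epsilon>)}"

definition dilation_class :: "(real^'d \<Rightarrow> real) \<Rightarrow> (real^'d \<Rightarrow> real) set" where
  "dilation_class \<Lambda> = {\<lambda>z. \<Lambda> ((x - z) /\<^sub>R h) | x h. h > 0}"

definition covering_number_condition :: "(real^'d \<Rightarrow> real) \<Rightarrow> bool" where
  "covering_number_condition \<Lambda> \<longleftrightarrow>
     (\<exists>A v. A > 0 \<and> v > 0 \<and>
       (\<forall>Q :: (real^'d) measure. prob_space Q \<and> sets Q = sets borel \<longrightarrow>
         (\<forall>\<epsilon>. 0 < \<epsilon> \<and> \<epsilon> < 1 \<longrightarrow>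
           ereal_of_enat (covering_number (\<epsilon> * (SUP z. \<bar>\<Lambda> z\<bar>)) Q (dilation_class \<Lambda>))
             \<le> ereal ((A / \<epsilon>) powr v))))"

definition asymptotic_as_confidence_regions ::
  "'w measure \<Rightarrow> (nat \<Rightarrow> 'w \<Rightarrow> 'b set) \<Rightarrow> 'b \<Rightarrow> bool"
where
  "asymptotic_as_confidence_regions M D \<theta> \<longleftrightarrow>
     (\<exists>\<Omega>\<^sub>0\<in>sets M. measure M \<Omega>\<^sub>0 = 1 \<and> (\<forall>\<omega>\<in>\<Omega>\<^sub>0. \<exists>N. \<forall>n\<ge>N. \<theta> \<in> D n \<omega>))"

end

theory Submission
  imports Defs "HOL-Real_Asymp.Real_Asymp"
begin

text \<open>Let \<open>N n = n * hs n ^ d / (v n)\<^sup>2\<close>. For the upper bound, the region misses \<open>f\<close> somewhere on \<open>C\<close> only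
  if, at some point of a finite grid, \<open>f\<^sub>n\<^sup>*\<close> deviates from its mean by almost \<open>\<delta> sqrt (\<kappa> max f \<epsilon>) / v\<close> or
  \<open>f\<^sub>n\<close> deviates from its mean by a multiple of \<open>\<epsilon>\<close>. Exponential moments bound both probabilities
  uniformly in the grid point; the second one is negligible because \<open>n h\<^sup>d \<epsilon>\<^sup>2\<close> is of larger order than
  \<open>N\<close>. As \<open>K\<close> is Hoelder continuous, a grid of mesh a power of \<open>hs\<close> suffices, and its
  cardinality is \<open>exp (o(N))\<close>; so the union bound replaces entropy and Talagrand-type inequalities.
  The lower bound is the Gaussian Gaertner--Ellis lower bound at a single point of \<open>C\<close> where \<open>f\<close> is
  positive, and the almost sure statement follows by Borel--Cantelli.\<close>

section \<open>Exponential moments and the Gaertner--Ellis lower bound\<close>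

text \<open>The limit does not depend on \<open>f\<close> because the band is self-normalised. With
  \<open>m = max (f x) \<epsilon>\<close>, the Chernoff parameter
  \<open>\<gamma> / (v * sqrt (\<kappa> * m))\<close> makes the linear gain equal to
  \<open>\<gamma>\<^sup>2 / v\<^sup>2\<close> and the quadratic cost asymptotically half of it:
  \<open>m\<close> cancels, and the bound is uniform over the whole space. The obstacle is the
  region where \<open>f\<close> is close to 0, where an error of order \<open>hs\<close> in the
  second moment is not small relative to \<open>f\<close>. The floor \<open>\<epsilon>\<close>
  repairs this: the error becomes a relative one of order \<open>hs / \<epsilon>\<close>, and the
  parameter stays below a multiple of \<open>1 / (v * sqrt \<epsilon>)\<close>, so that the higher
  terms of the exponential vanish. In exchange the width is random through the truncated estimator,
  and replacing it by its value at \<open>m\<close> costs a relative error that is sent to 0 after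
  \<open>n\<close>.\<close>

lemma exp_le_quadratic:
  fixes x c :: real
  assumes "\<bar>x\<bar> \<le> c"
  shows "exp x \<le> 1 + x + x\<^sup>2 / 2 * exp c"
proof -
  obtain t where t: "\<bar>t\<bar> \<le> \<bar>x\<bar>" "exp x = (\<Sum>m<2. x ^ m / fact m) + exp t / fact 2 * x ^ 2"
    using Maclaurin_exp_le[of x 2] by blast
  have "exp t * x\<^sup>2 \<le> exp c * x\<^sup>2"
    using t(1) assms by (intro mult_right_mono) auto
  then show ?thesis
    using t(2) by (simp add: numeral_2_eq_2 power2_eq_square mult.commute)
qed

lemma exp_ge_quadratic:
  fixes x c :: real
  assumes "\<bar>x\<bar> \<le> c"
  shows "1 + x + x\<^sup>2 / 2 * exp (- c) \<le> exp x"
proof -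
  obtain t where t: "\<bar>t\<bar> \<le> \<bar>x\<bar>" "exp x = (\<Sum>m<2. x ^ m / fact m) + exp t / fact 2 * x ^ 2"
    using Maclaurin_exp_le[of x 2] by blast
  have "exp (- c) * x\<^sup>2 \<le> exp t * x\<^sup>2"
    using t(1) assms by (intro mult_right_mono) auto
  then show ?thesis
    using t(2) by (simp add: numeral_2_eq_2 power2_eq_square mult.commute)
qed

context prob_space
begin

lemma integrable_bounded_rv:
  fixes Y :: "'a \<Rightarrow> real"
  assumes "Y \<in> borel_measurable M" "\<And>\<omega>. \<omega> \<in> space M \<Longrightarrow> \<bar>Y \<omega>\<bar> \<le> b"
  shows "integrable M Y"
  using assms by (intro integrable_const_bound[where B = b] AE_I2) auto

text \<open>The second-order expansion of \<open>exp\<close> on \<open>[-c, c]\<close>, integrated.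
  The bound \<open>c\<close> is a separate parameter because it tends to 0 in the sharp
  applications, where \<open>exp c\<close> and \<open>exp (- c)\<close> both become 1 and the two
  estimates meet.\<close>

lemma mgf_bounded_rv:
  fixes Y :: "'a \<Rightarrow> real"
  assumes [measurable]: "Y \<in> borel_measurable M"
    and b: "\<And>\<omega>. \<omega> \<in> space M \<Longrightarrow> \<bar>Y \<omega>\<bar> \<le> b" and c: "\<bar>t\<bar> * b \<le> c"
  shows "integrable M (\<lambda>\<omega>. exp (t * Y \<omega>))"
    and "expectation (\<lambda>\<omega>. exp (t * Y \<omega>))
           \<le> 1 + t * expectation Y + t\<^sup>2 * expectation (\<lambda>\<omega>. (Y \<omega>)\<^sup>2) / 2 * exp c"
    and "1 + t * expectation Y + t\<^sup>2 * expectation (\<lambda>\<omega>. (Y \<omega>)\<^sup>2) / 2 * exp (- c)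
           \<le> expectation (\<lambda>\<omega>. exp (t * Y \<omega>))"
proof -
  have tY: "\<bar>t * Y \<omega>\<bar> \<le> c" if "\<omega> \<in> space M" for \<omega>
    using mult_left_mono[OF b[OF that], of "\<bar>t\<bar>"] c by (simp add: abs_mult)
  show int_exp: "integrable M (\<lambda>\<omega>. exp (t * Y \<omega>))"
    using tY by (intro integrable_bounded_rv[where b = "exp c"]) (auto simp: abs_le_iff)
  have int_Y: "integrable M Y"
    using b by (intro integrable_bounded_rv[where b = b]) auto
  have int_Y2: "integrable M (\<lambda>\<omega>. (Y \<omega>)\<^sup>2)"
    using b power_mono[OF b abs_ge_zero, of _ 2]
    by (intro integrable_bounded_rv[where b = "b\<^sup>2"]) auto
  have eq: "expectation (\<lambda>\<omega>. 1 + t * Y \<omega> + (t * Y \<omega>)\<^sup>2 / 2 * a)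
      = 1 + t * expectation Y + t\<^sup>2 * expectation (\<lambda>\<omega>. (Y \<omega>)\<^sup>2) / 2 * a"
    and int: "integrable M (\<lambda>\<omega>. 1 + t * Y \<omega> + (t * Y \<omega>)\<^sup>2 / 2 * a)" for a
    using int_Y int_Y2 by (simp_all add: power_mult_distrib prob_space)
  show "expectation (\<lambda>\<omega>. exp (t * Y \<omega>))
           \<le> 1 + t * expectation Y + t\<^sup>2 * expectation (\<lambda>\<omega>. (Y \<omega>)\<^sup>2) / 2 * exp c"
    unfolding eq[symmetric] by (intro integral_mono int_exp int exp_le_quadratic tY)
  show "1 + t * expectation Y + t\<^sup>2 * expectation (\<lambda>\<omega>. (Y \<omega>)\<^sup>2) / 2 * exp (- c)
           \<le> expectation (\<lambda>\<omega>. exp (t * Y \<omega>))"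
    unfolding eq[symmetric] by (intro integral_mono int_exp int exp_ge_quadratic tY)
qed

text \<open>The Gaertner--Ellis lower bound is usually obtained by a change of measure. For a Gaussian
  rate function the limits of the moment generating functions suffice: the
  expectation of \<open>exp (N t Z)\<close> is carried by the event \<open>\<bar>Z - t s\<bar> < \<psi> s\<close>, because Chernoff's bound
  makes the contributions of both tails exponentially smaller.\<close>

lemma prob_gt_lower_bound:
  fixes Z :: "'a \<Rightarrow> real"
  assumes [measurable]: "Z \<in> borel_measurable M"
    and int: "\<And>r. integrable M (\<lambda>\<omega>. exp (N * r * Z \<omega>))"
    and pos: "s > 0" "0 < \<psi>" "\<psi> \<le> t" "N > 0"
    and \<rho>: "\<rho> = \<psi>\<^sup>2 * s / 8"
    and lower: "exp (N * (t\<^sup>2 * s / 2 - \<rho>)) \<le> expectation (\<lambda>\<omega>. exp (N * t * Z \<omega>))"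
    and upper: "\<And>r. r \<in> {t + \<psi>, t - \<psi>} \<Longrightarrow>
      expectation (\<lambda>\<omega>. exp (N * r * Z \<omega>)) \<le> exp (N * (r\<^sup>2 * s / 2 + \<rho>))"
    and N: "ln 4 \<le> 2 * N * \<rho>"
  shows "exp (- (N * ((t\<^sup>2 / 2 + t * \<psi> + \<psi>\<^sup>2 / 8) * s))) / 2
    \<le> prob {\<omega> \<in> space M. Z \<omega> > (t - \<psi>) * s}"
proof -
  define A where "A = {\<omega> \<in> space M. Z \<omega> > (t - \<psi>) * s}"
  have [measurable]: "A \<in> sets M" unfolding A_def by measurable
  define lo hi where "lo = (t - \<psi>) * s" and "hi = (t + \<psi>) * s"
  let ?k = "exp (N * t * hi)"
  have pt: "exp (N * t * Z \<omega>) \<le> ?k * indicator A \<omega>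
      + (exp (- (N * \<psi> * hi)) * exp (N * (t + \<psi>) * Z \<omega>)
         + exp (N * \<psi> * lo) * exp (N * (t - \<psi>) * Z \<omega>))" (is "_ \<le> ?c + (?a + ?b)")
    if "\<omega> \<in> space M" for \<omega>
  proof -
    \<comment> \<open>Both terms are the integrand times a factor that is 1 at the cut point and at
      least 1 beyond it: Chernoff's bound in pointwise form.\<close>
    have a: "?a = exp (N * t * Z \<omega>) * exp (N * \<psi> * (Z \<omega> - hi))"
      unfolding exp_add[symmetric] by (rule arg_cong[of _ _ exp]) algebra
    have b: "?b = exp (N * t * Z \<omega>) * exp (N * \<psi> * (lo - Z \<omega>))"
      unfolding exp_add[symmetric] by (rule arg_cong[of _ _ exp]) algebra
    have nonneg: "?a \<ge> 0" "?b \<ge> 0" "?c \<ge> 0" by auto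
    consider "Z \<omega> \<le> lo" | "Z \<omega> \<ge> hi" | "lo < Z \<omega>" "Z \<omega> < hi" by linarith
    then show ?thesis
    proof cases
      case 1
      then have "exp (N * t * Z \<omega>) * 1 \<le> ?b"
        unfolding b using pos by (intro mult_left_mono) auto
      then show ?thesis using nonneg by linarith
    next
      case 2
      then have "exp (N * t * Z \<omega>) * 1 \<le> ?a"
        unfolding a using pos by (intro mult_left_mono) auto
      then show ?thesis using nonneg by linarith
    next
      case 3
      have "N * t * Z \<omega> \<le> N * t * hi"
        using 3 pos by (intro mult_left_mono) auto
      then have "exp (N * t * Z \<omega>) \<le> ?c"
        using 3 that by (auto simp: A_def lo_def)
      then show ?thesis using nonneg by linarith
    qed
  qed
  have int': "integrable M (\<lambda>\<omega>. ?k * indicator A \<omega>)"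
    "integrable M (\<lambda>\<omega>. c * exp (N * r * Z \<omega>))" for c r
    using int by (simp_all add: emeasure_eq_measure)
  have "expectation (\<lambda>\<omega>. exp (N * t * Z \<omega>))
      \<le> expectation (\<lambda>\<omega>. ?k * indicator A \<omega> + (exp (- (N * \<psi> * hi)) * exp (N * (t + \<psi>) * Z \<omega>)
         + exp (N * \<psi> * lo) * exp (N * (t - \<psi>) * Z \<omega>)))"
    by (intro integral_mono pt int int' Bochner_Integration.integrable_add)
  also have "\<dots> = ?k * prob A
      + (exp (- (N * \<psi> * hi)) * expectation (\<lambda>\<omega>. exp (N * (t + \<psi>) * Z \<omega>))
         + exp (N * \<psi> * lo) * expectation (\<lambda>\<omega>. exp (N * (t - \<psi>) * Z \<omega>)))"
    by (simp only: Bochner_Integration.integral_add Bochner_Integration.integrable_add int'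
        integral_mult_right_zero) (simp add: emeasure_eq_measure)
  also have "\<dots> \<le> ?k * prob A
      + (exp (- (N * \<psi> * hi)) * exp (N * ((t + \<psi>)\<^sup>2 * s / 2 + \<rho>))
         + exp (N * \<psi> * lo) * exp (N * ((t - \<psi>)\<^sup>2 * s / 2 + \<rho>)))"
    using upper by (intro add_mono mult_left_mono) auto
  \<comment> \<open>After completing the square each tail has exponent
    \<open>t\<^sup>2 * s / 2 - \<psi>\<^sup>2 * s / 2 + \<rho>\<close>. Since
    \<open>\<psi>\<^sup>2 * s / 2 = 4 * \<rho>\<close>, this lies \<open>2 * \<rho>\<close> below
    the exponent in \<open>lower\<close>; hence the 8 in \<open>\<rho>\<close>. The assumption on
    \<open>ln 4\<close> then makes each tail at most a quarter of the lower bound.\<close>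
  also have "exp (- (N * \<psi> * hi)) * exp (N * ((t + \<psi>)\<^sup>2 * s / 2 + \<rho>))
      = exp (N * (t\<^sup>2 * s / 2 - \<rho>)) * exp (- (2 * N * \<rho>))"
    unfolding exp_add[symmetric] hi_def \<rho>
    by (rule arg_cong[of _ _ exp]) (simp add: power2_eq_square field_simps)
  also have "exp (N * \<psi> * lo) * exp (N * ((t - \<psi>)\<^sup>2 * s / 2 + \<rho>))
      = exp (N * (t\<^sup>2 * s / 2 - \<rho>)) * exp (- (2 * N * \<rho>))"
    unfolding exp_add[symmetric] lo_def \<rho>
    by (rule arg_cong[of _ _ exp]) (simp add: power2_eq_square field_simps)
  finally have main: "exp (N * (t\<^sup>2 * s / 2 - \<rho>)) * (1 - 2 * exp (- (2 * N * \<rho>))) \<le> ?k * prob A"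
    using lower by (simp add: algebra_simps)
  have "exp (- (2 * N * \<rho>)) \<le> exp (- ln 4)" using N by simp
  then have "1 / 2 \<le> 1 - 2 * exp (- (2 * N * \<rho>))" by (simp add: exp_minus)
  then have "exp (N * (t\<^sup>2 * s / 2 - \<rho>)) * (1 / 2)
      \<le> exp (N * (t\<^sup>2 * s / 2 - \<rho>)) * (1 - 2 * exp (- (2 * N * \<rho>)))"
    by (intro mult_left_mono) auto
  then have "exp (N * (t\<^sup>2 * s / 2 - \<rho>)) / 2 \<le> ?k * prob A" using main by linarith
  then have "exp (- (N * t * hi)) * (exp (N * (t\<^sup>2 * s / 2 - \<rho>)) / 2)
      \<le> exp (- (N * t * hi)) * (?k * prob A)"
    by (intro mult_left_mono) auto
  also have "\<dots> = prob A" by (simp add: exp_minus)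
  also have "exp (- (N * t * hi)) * (exp (N * (t\<^sup>2 * s / 2 - \<rho>)) / 2)
      = exp (- (N * ((t\<^sup>2 / 2 + t * \<psi> + \<psi>\<^sup>2 / 8) * s))) / 2"
    unfolding times_divide_eq_right exp_add[symmetric] hi_def \<rho>
    by (rule arg_cong[of _ _ "\<lambda>x. exp x / 2"]) (simp add: power2_eq_square field_simps)
  finally show ?thesis unfolding A_def .
qed

text \<open>The tilt \<open>\<tau> / s + \<psi>\<close> puts the lower edge
  \<open>(t - \<psi>) * s\<close> of the window exactly at \<open>\<tau>\<close>. As
  \<open>\<psi>\<close> tends to 0, the exponent \<open>?g \<psi>\<close> tends to
  \<open>\<tau>\<^sup>2 / (2 * s)\<close>, the Legendre transform of
  \<open>t\<^sup>2 * s / 2\<close>.\<close>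

lemma Gaertner_Ellis_Gaussian_lower_bound:
  fixes Z :: "nat \<Rightarrow> 'a \<Rightarrow> real" and N :: "nat \<Rightarrow> real"
  assumes meas: "\<And>n. Z n \<in> borel_measurable M"
    and N: "filterlim N at_top sequentially"
    and int: "\<forall>\<^sub>F n in sequentially. \<forall>t. integrable M (\<lambda>\<omega>. exp (N n * t * Z n \<omega>))"
    and s: "s > 0"
    and upper: "\<And>t \<eta>. \<eta> > 0 \<Longrightarrow> \<forall>\<^sub>F n in sequentially.
      expectation (\<lambda>\<omega>. exp (N n * t * Z n \<omega>)) \<le> exp (N n * (t\<^sup>2 * s / 2 + \<eta>))"
    and lower: "\<And>t \<eta>. t > 0 \<Longrightarrow> \<eta> > 0 \<Longrightarrow> \<forall>\<^sub>F n in sequentially.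
      exp (N n * (t\<^sup>2 * s / 2 - \<eta>)) \<le> expectation (\<lambda>\<omega>. exp (N n * t * Z n \<omega>))"
    and "\<tau> \<ge> 0" "\<eta> > 0"
  shows "\<forall>\<^sub>F n in sequentially.
    exp (- (N n * (\<tau>\<^sup>2 / (2 * s) + \<eta>))) \<le> prob {\<omega> \<in> space M. Z n \<omega> > \<tau>}"
proof -
  let ?g = "\<lambda>\<psi>. ((\<tau> / s + \<psi>)\<^sup>2 / 2 + (\<tau> / s + \<psi>) * \<psi> + \<psi>\<^sup>2 / 8) * s"
  have "(?g \<longlongrightarrow> ((\<tau> / s + 0)\<^sup>2 / 2 + (\<tau> / s + 0) * 0 + 0\<^sup>2 / 8) * s) (at_right 0)"
    by (intro tendsto_intros) auto
  moreover have "((\<tau> / s + 0)\<^sup>2 / 2 + (\<tau> / s + 0) * 0 + 0\<^sup>2 / 8) * s < \<tau>\<^sup>2 / (2 * s) + \<eta> / 2"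
    using \<open>\<eta> > 0\<close> s by (simp add: power2_eq_square)
  ultimately have "\<forall>\<^sub>F \<psi> in at_right 0. ?g \<psi> < \<tau>\<^sup>2 / (2 * s) + \<eta> / 2"
    by (rule order_tendstoD)
  then have "\<forall>\<^sub>F \<psi> in at_right 0. ?g \<psi> < \<tau>\<^sup>2 / (2 * s) + \<eta> / 2 \<and> (0::real) < \<psi>"
    using eventually_at_right_less by eventually_elim auto
  then obtain \<psi> where \<psi>: "\<psi> > 0" "?g \<psi> < \<tau>\<^sup>2 / (2 * s) + \<eta> / 2"
    using eventually_happens[of _ "at_right (0::real)"] trivial_limit_at_right_real by blast
  define \<rho> where "\<rho> = \<psi>\<^sup>2 * s / 8"
  define t where "t = \<tau> / s + \<psi>"
  have "\<rho> > 0" "t > 0" "\<psi> \<le> t" and \<tau>: "(t - \<psi>) * s = \<tau>"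
    using \<psi>(1) s \<open>\<tau> \<ge> 0\<close> by (auto simp: \<rho>_def t_def intro: add_nonneg_pos)
  show ?thesis
    using lower[OF \<open>t > 0\<close> \<open>\<rho> > 0\<close>] upper[OF \<open>\<rho> > 0\<close>, of "t + \<psi>"] upper[OF \<open>\<rho> > 0\<close>, of "t - \<psi>"] int
      \<comment> \<open>The first threshold is the one required by
        \<open>prob_gt_lower_bound\<close>; the second makes
        \<open>exp (- (N n * \<eta> / 2))\<close> at most 1/2, which absorbs the factor 1/2 of that
        lemma.\<close>
      filterlim_at_top_dense[THEN iffD1, OF N, rule_format, of "ln 4 / (2 * \<rho>)"]
      filterlim_at_top_dense[THEN iffD1, OF N, rule_format, of "2 * ln 2 / \<eta>"]
      filterlim_at_top_dense[THEN iffD1, OF N, rule_format, of 0]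
  proof eventually_elim
    case (elim n)
    define a where "a = \<tau>\<^sup>2 / (2 * s)"
    have "exp (- (N n * ((t\<^sup>2 / 2 + t * \<psi> + \<psi>\<^sup>2 / 8) * s))) / 2 \<le> prob {\<omega> \<in> space M. Z n \<omega> > (t - \<psi>) * s}"
    proof (rule prob_gt_lower_bound[OF meas, where \<rho> = \<rho>])
      show "expectation (\<lambda>\<omega>. exp (N n * r * Z n \<omega>)) \<le> exp (N n * (r\<^sup>2 * s / 2 + \<rho>))"
        if "r \<in> {t + \<psi>, t - \<psi>}" for r
        using that elim(2,3) by blast
      show "ln 4 \<le> 2 * N n * \<rho>"
        using elim(5) \<open>\<rho> > 0\<close> by (simp add: divide_less_eq mult_ac)
    qed (use elim(1,4,7) s \<psi>(1) \<open>\<psi> \<le> t\<close> in \<open>auto simp: \<rho>_def\<close>)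
    moreover have "exp (- (N n * (a + \<eta> / 2))) \<le> exp (- (N n * ((t\<^sup>2 / 2 + t * \<psi> + \<psi>\<^sup>2 / 8) * s)))"
      using elim(7) \<psi>(2) by (auto simp: t_def a_def intro!: mult_left_mono)
    moreover have "exp (- (N n * \<eta> / 2)) \<le> exp (- ln 2)"
      using elim(6) \<open>\<eta> > 0\<close> by (simp add: divide_less_eq)
    then have "exp (- (N n * (a + \<eta> / 2))) * exp (- (N n * \<eta> / 2))
      \<le> exp (- (N n * (a + \<eta> / 2))) * (1 / 2)"
      by (intro mult_left_mono) (auto simp: exp_minus)
    moreover have "exp (- (N n * (a + \<eta>))) = exp (- (N n * (a + \<eta> / 2))) * exp (- (N n * \<eta> / 2))"
      unfolding exp_add[symmetric] by (rule arg_cong[of _ _ exp]) (simp add: field_simps)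
    ultimately show ?case unfolding \<tau> a_def by linarith
  qed
qed

text \<open>\<open>C\<close> may be uncountable, but positivity of a continuous function is an open
  condition, so a countable dense subset of \<open>C\<close> already contains a witness.\<close>

lemma sets_ex_continuous_pos:
  fixes g :: "'a \<Rightarrow> 'b::{metric_space, second_countable_topology} \<Rightarrow> real"
  assumes "\<And>\<omega>. \<omega> \<in> space M \<Longrightarrow> continuous_on C (g \<omega>)"
    and [measurable]: "\<And>x. (\<lambda>\<omega>. g \<omega> x) \<in> borel_measurable M"
  shows "{\<omega> \<in> space M. \<exists>x\<in>C. g \<omega> x > 0} \<in> sets M"
proof -
  obtain S where S: "countable S" "S \<subseteq> C" "C \<subseteq> closure S" using separable by blast
  have "\<exists>x\<in>S. g \<omega> x > 0" if "\<omega> \<in> space M" "x \<in> C" "g \<omega> x > 0" for \<omega> x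
  proof -
    have "openin (top_of_set C) (C \<inter> g \<omega> -` {0<..})"
      using assms(1)[OF that(1)] by (intro continuous_openin_preimage_gen) auto
    then obtain U where U: "open U" "C \<inter> g \<omega> -` {0<..} = C \<inter> U" unfolding openin_open by blast
    have "x \<in> U \<inter> closure S" using that U S by blast
    then have "U \<inter> S \<noteq> {}" using U open_Int_closure_eq_empty by blast
    then show ?thesis using U S by blast
  qed
  then have "{\<omega> \<in> space M. \<exists>x\<in>C. g \<omega> x > 0} = {\<omega> \<in> space M. \<exists>x\<in>S. g \<omega> x > 0}"
    using S by blast
  also have "\<dots> \<in> sets M" using S(1) by measurable
  finally show ?thesis .
qed

end

section \<open>Exponential moments of kernel density estimators\<close>

lemma integral_lborel_affine:
  fixes \<phi> :: "'a::euclidean_space \<Rightarrow> real"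
  assumes [measurable]: "\<phi> \<in> borel_measurable borel" and "c \<noteq> 0"
  shows "(\<integral>x. \<phi> x \<partial>lborel) = \<bar>c\<bar> ^ DIM('a) * (\<integral>x. \<phi> (t + c *\<^sub>R x) \<partial>lborel)"
  by (subst lborel_affine[OF \<open>c \<noteq> 0\<close>, of t])
    (simp add: ennreal_power integral_real_density integral_distr)

lemma GDERIV_bounded_imp_lipschitz:
  fixes f :: "'a::euclidean_space \<Rightarrow> real"
  assumes "\<And>x. GDERIV f x :> grad_f x" "\<And>x. norm (grad_f x) \<le> G"
  shows "\<bar>f x - f y\<bar> \<le> G * norm (x - y)"
proof -
  have "onorm (\<lambda>h. h \<bullet> grad_f z) \<le> G" for z
    using assms(2)[of z] Cauchy_Schwarz_ineq2[of _ "grad_f z"]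
    by (intro onorm_le) (smt (verit, best) mult.commute mult_right_mono norm_ge_zero real_norm_def)
  then have "norm (f x - f y) \<le> G * norm (x - y)"
    using assms(1) by (intro differentiable_bound[where S = UNIV and f' = "\<lambda>z h. h \<bullet> grad_f z"])
      (auto simp: gderiv_def)
  then show ?thesis by simp
qed

text \<open>The mean value theorem along the segment, followed by the Lipschitz bound for the
  gradient. This works for a second derivative that is merely bounded; it gives \<open>H\<close>
  where an integral remainder would give \<open>H / 2\<close>, and only the order in
  \<open>norm w\<close> matters later.\<close>

lemma GDERIV_Taylor_bound:
  fixes f :: "'a::euclidean_space \<Rightarrow> real"
  assumes f: "\<And>x. GDERIV f x :> grad_f x"
    and g: "\<And>x. (grad_f has_derivative blinfun_apply (D2f x)) (at x)"
    and H: "\<And>x. norm (D2f x) \<le> H"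
  shows "\<bar>f (x + w) - f x - w \<bullet> grad_f x\<bar> \<le> H * (norm w)\<^sup>2"
proof -
  have lip: "norm (grad_f y - grad_f x) \<le> H * norm (y - x)" for y
    using g H by (intro differentiable_bound[where S = UNIV and f' = "\<lambda>z. blinfun_apply (D2f z)"])
      (auto simp: norm_blinfun.rep_eq[symmetric])
  have "((\<lambda>t. f (x + t *\<^sub>R w)) has_derivative (\<lambda>s. (s *\<^sub>R w) \<bullet> grad_f (x + t *\<^sub>R w))) (at t within {0..1})" for t
    by (rule has_derivative_compose[where g = f and f = "\<lambda>t. x + t *\<^sub>R w", OF _ f[unfolded gderiv_def]])
      (auto intro!: derivative_eq_intros)
  then obtain t where t: "t \<in> {0<..<1}" "f (x + 1 *\<^sub>R w) - f (x + 0 *\<^sub>R w) = ((1 - 0) *\<^sub>R w) \<bullet> grad_f (x + t *\<^sub>R w)"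
    using mvt_simple[of 0 1 "\<lambda>t. f (x + t *\<^sub>R w)" "\<lambda>t s. (s *\<^sub>R w) \<bullet> grad_f (x + t *\<^sub>R w)"] by auto
  then have "f (x + w) - f x - w \<bullet> grad_f x = w \<bullet> (grad_f (x + t *\<^sub>R w) - grad_f x)"
    by (simp add: inner_diff_right)
  also have "\<bar>\<dots>\<bar> \<le> norm w * norm (grad_f (x + t *\<^sub>R w) - grad_f x)"
    by (rule Cauchy_Schwarz_ineq2)
  also have "\<dots> \<le> norm w * (H * norm w)"
  proof (intro mult_left_mono)
    have "H \<ge> 0" using H[of x] norm_ge_zero[of "D2f x"] by linarith
    then have "H * (t * norm w) \<le> H * (1 * norm w)"
      using t(1) by (intro mult_left_mono mult_right_mono) auto
    then show "norm (grad_f (x + t *\<^sub>R w) - grad_f x) \<le> H * norm w"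
      using lip[of "x + t *\<^sub>R w"] t(1) by auto
  qed auto
  finally show ?thesis by (simp add: power2_eq_square mult_ac)
qed

locale kernel_density = prob_space M for M :: "'w measure" +
  fixes X :: "nat \<Rightarrow> 'w \<Rightarrow> real^'d"
    and f K :: "real^'d \<Rightarrow> real" and b :: real
  assumes indep: "indep_vars (\<lambda>_. borel) X {1..}"
    and density: "\<And>j. j \<ge> 1 \<Longrightarrow> distributed M lborel (X j) (\<lambda>x. ennreal (f x))"
    and f_nonneg: "\<And>x. f x \<ge> 0"
    and f_cont: "continuous_on UNIV f"
    and K_nonneg: "\<And>z. K z \<ge> 0" and K_le: "\<And>z. K z \<le> b"
    and K_cont: "continuous_on UNIV K"
begin

text \<open>The smoothing integral after the substitution \<open>y = x - h *\<^sub>R z\<close>,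
  which makes its limit as \<open>h\<close> tends to 0 visible. For \<open>\<phi> = K\<close> it is
  the mean of the estimator; for the square of \<open>K\<close> it is the second moment of a kernel
  term divided by \<open>h ^ CARD('d)\<close>.\<close>

definition mollify :: "(real^'d \<Rightarrow> real) \<Rightarrow> real \<Rightarrow> real^'d \<Rightarrow> real" where
  "mollify \<phi> h x = (\<integral>z. f (x - h *\<^sub>R z) * \<phi> z \<partial>lborel)"

definition deviation :: "real \<Rightarrow> nat \<Rightarrow> real^'d \<Rightarrow> 'w \<Rightarrow> real" where
  "deviation h n x \<omega> = kde K h X n \<omega> x - mollify K h x"

lemma f_measurable [measurable]: "f \<in> borel_measurable borel"
  using f_cont by (rule borel_measurable_continuous_onI)

lemma K_measurable [measurable]: "K \<in> borel_measurable borel"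
  using K_cont by (rule borel_measurable_continuous_onI)

lemma X_measurable: "j \<ge> 1 \<Longrightarrow> X j \<in> borel_measurable M"
  using distributed_measurable[OF density] by simp

lemma kde_measurable [measurable]: "(\<lambda>\<omega>. kde K h X n \<omega> x) \<in> borel_measurable M"
  unfolding kde_def using X_measurable
  by (intro borel_measurable_times borel_measurable_const borel_measurable_sum
      measurable_compose[OF _ K_measurable] borel_measurable_scaleR borel_measurable_diff) auto

lemma deviation_measurable [measurable]: "deviation h n x \<in> borel_measurable M"
  unfolding deviation_def by measurable

lemma b_nonneg: "b \<ge> 0"
  using K_nonneg[of 0] K_le[of 0] by linarith

lemma expectation_kernel:
  assumes "j \<ge> 1" "h > 0" and [measurable]: "\<phi> \<in> borel_measurable borel"
  shows "expectation (\<lambda>\<omega>. \<phi> ((x - X j \<omega>) /\<^sub>R h)) = h ^ CARD('d) * mollify \<phi> h x"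
proof -
  have "expectation (\<lambda>\<omega>. \<phi> ((x - X j \<omega>) /\<^sub>R h)) = (\<integral>y. f y * \<phi> ((x - y) /\<^sub>R h) \<partial>lborel)"
    by (rule distributed_integral[OF density, symmetric]) (use assms f_nonneg in auto)
  also have "\<dots> = \<bar>- h\<bar> ^ CARD('d) * (\<integral>z. f (x + (- h) *\<^sub>R z) * \<phi> ((x - (x + (- h) *\<^sub>R z)) /\<^sub>R h) \<partial>lborel)"
    using integral_lborel_affine[of "\<lambda>y. f y * \<phi> ((x - y) /\<^sub>R h)" "- h" x] \<open>h > 0\<close> by simp
  also have "\<dots> = h ^ CARD('d) * mollify \<phi> h x"
    using \<open>h > 0\<close> by (simp add: mollify_def)
  finally show ?thesis .
qed

lemma mgf_kernel:
  fixes x :: "real^'d"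
  assumes j: "j \<ge> 1" and h: "h > 0" and c: "\<bar>t\<bar> * b \<le> c"
  defines "m \<equiv> mollify K h x" and "q \<equiv> mollify (\<lambda>z. (K z)\<^sup>2) h x"
  shows "integrable M (\<lambda>\<omega>. exp (t * K ((x - X j \<omega>) /\<^sub>R h)))"
    and "expectation (\<lambda>\<omega>. exp (t * K ((x - X j \<omega>) /\<^sub>R h)))
      \<le> 1 + h ^ CARD('d) * (t * m + t\<^sup>2 * q / 2 * exp c)"
    and "1 + h ^ CARD('d) * (t * m + t\<^sup>2 * q / 2 * exp (- c))
      \<le> expectation (\<lambda>\<omega>. exp (t * K ((x - X j \<omega>) /\<^sub>R h)))"
proof -
  have meas: "(\<lambda>\<omega>. K ((x - X j \<omega>) /\<^sub>R h)) \<in> borel_measurable M"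
    using X_measurable[OF j] by measurable
  have le: "\<bar>K ((x - X j \<omega>) /\<^sub>R h)\<bar> \<le> b" for \<omega>
    using K_nonneg K_le by simp
  have EK: "expectation (\<lambda>\<omega>. K ((x - X j \<omega>) /\<^sub>R h)) = h ^ CARD('d) * m"
    "expectation (\<lambda>\<omega>. (K ((x - X j \<omega>) /\<^sub>R h))\<^sup>2) = h ^ CARD('d) * q"
    unfolding m_def q_def
    using expectation_kernel[OF j h, of K x] expectation_kernel[OF j h, of "\<lambda>z. (K z)\<^sup>2" x] by simp_all
  show "integrable M (\<lambda>\<omega>. exp (t * K ((x - X j \<omega>) /\<^sub>R h)))"
    using mgf_bounded_rv(1)[OF meas le c] by simp
  show "expectation (\<lambda>\<omega>. exp (t * K ((x - X j \<omega>) /\<^sub>R h)))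
      \<le> 1 + h ^ CARD('d) * (t * m + t\<^sup>2 * q / 2 * exp c)"
    using mgf_bounded_rv(2)[OF meas le c, unfolded EK] by (simp add: algebra_simps)
  show "1 + h ^ CARD('d) * (t * m + t\<^sup>2 * q / 2 * exp (- c))
      \<le> expectation (\<lambda>\<omega>. exp (t * K ((x - X j \<omega>) /\<^sub>R h)))"
    using mgf_bounded_rv(3)[OF meas le c, unfolded EK] by (simp add: algebra_simps)
qed

text \<open>The factor \<open>real n * h ^ CARD('d)\<close> undoes the normalisation of
  \<open>kde\<close>, so \<open>t\<close> multiplies each kernel value directly and the size
  condition \<open>\<bar>t\<bar> * b \<le> c\<close> involves neither \<open>n\<close> nor
  \<open>h\<close>.\<close>

lemma mgf_deviation:
  assumes n: "n \<ge> 1" and h: "h > 0"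
  shows "integrable M (\<lambda>\<omega>. exp (real n * h ^ CARD('d) * t * deviation h n x \<omega>))"
    and "expectation (\<lambda>\<omega>. exp (real n * h ^ CARD('d) * t * deviation h n x \<omega>))
      = (\<Prod>j=1..n. exp (- (h ^ CARD('d) * t * mollify K h x))
          * expectation (\<lambda>\<omega>. exp (t * K ((x - X j \<omega>) /\<^sub>R h))))"
proof -
  let ?m = "h ^ CARD('d) * t * mollify K h x"
  have eq: "exp (real n * h ^ CARD('d) * t * deviation h n x \<omega>)
      = (\<Prod>j=1..n. exp (- ?m) * exp (t * K ((x - X j \<omega>) /\<^sub>R h)))" for \<omega>
  proof -
    have "real n * h ^ CARD('d) * t * deviation h n x \<omega>
      = t * (\<Sum>j=1..n. K ((x - X j \<omega>) /\<^sub>R h)) - real n * ?m"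
      using n h by (simp add: deviation_def kde_def field_simps)
    also have "\<dots> = (\<Sum>j=1..n. - ?m + t * K ((x - X j \<omega>) /\<^sub>R h))"
      by (simp add: sum_subtractf sum_distrib_left)
    finally show ?thesis by (simp only: exp_sum exp_add finite_atLeastAtMost)
  qed
  have "indep_vars (\<lambda>_. borel) (\<lambda>j \<omega>. exp (- ?m) * exp (t * K ((x - X j \<omega>) /\<^sub>R h))) {1..n}"
    by (rule indep_vars_compose2[OF indep_vars_subset[OF indep]]) auto
  moreover have "integrable M (\<lambda>\<omega>. exp (- ?m) * exp (t * K ((x - X j \<omega>) /\<^sub>R h)))" if "j \<in> {1..n}" for j
    using mgf_kernel(1)[of j h t "\<bar>t\<bar> * b" x] that h by simp
  ultimately have
    "integrable M (\<lambda>\<omega>. \<Prod>j=1..n. exp (- ?m) * exp (t * K ((x - X j \<omega>) /\<^sub>R h)))"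
    "expectation (\<lambda>\<omega>. \<Prod>j=1..n. exp (- ?m) * exp (t * K ((x - X j \<omega>) /\<^sub>R h)))
      = (\<Prod>j=1..n. expectation (\<lambda>\<omega>. exp (- ?m) * exp (t * K ((x - X j \<omega>) /\<^sub>R h))))"
    by (intro indep_vars_integrable indep_vars_lebesgue_integral; simp)+
  then show "integrable M (\<lambda>\<omega>. exp (real n * h ^ CARD('d) * t * deviation h n x \<omega>))"
    and "expectation (\<lambda>\<omega>. exp (real n * h ^ CARD('d) * t * deviation h n x \<omega>))
      = (\<Prod>j=1..n. exp (- (h ^ CARD('d) * t * mollify K h x))
          * expectation (\<lambda>\<omega>. exp (t * K ((x - X j \<omega>) /\<^sub>R h))))"
    unfolding eq by simp_all
qed

text \<open>By \<open>1 + u \<le> exp u\<close> the linear term cancels exactly against the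
  centring, and only the quadratic one survives.\<close>

lemma mgf_deviation_le:
  fixes x :: "real^'d"
  assumes n: "n \<ge> 1" and h: "h > 0" and c: "\<bar>t\<bar> * b \<le> c"
  defines "q \<equiv> mollify (\<lambda>z. (K z)\<^sup>2) h x"
  shows "expectation (\<lambda>\<omega>. exp (real n * h ^ CARD('d) * t * deviation h n x \<omega>))
    \<le> exp (real n * h ^ CARD('d) * (t\<^sup>2 * q / 2 * exp c))"
proof -
  let ?H = "h ^ CARD('d)" and ?m = "mollify K h x"
  have "expectation (\<lambda>\<omega>. exp (real n * ?H * t * deviation h n x \<omega>))
      \<le> (\<Prod>j=1..n. exp (?H * (t\<^sup>2 * q / 2 * exp c)))"
    unfolding mgf_deviation(2)[OF n h]
  proof (intro prod_mono conjI)
    fix j assume "j \<in> {1..n}"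
    then have "expectation (\<lambda>\<omega>. exp (t * K ((x - X j \<omega>) /\<^sub>R h)))
        \<le> 1 + ?H * (t * ?m + t\<^sup>2 * q / 2 * exp c)"
      unfolding q_def by (intro mgf_kernel(2) h c) simp
    also have "\<dots> \<le> exp (?H * (t * ?m + t\<^sup>2 * q / 2 * exp c))"
      by (rule exp_ge_add_one_self)
    finally have "exp (- (?H * t * ?m)) * expectation (\<lambda>\<omega>. exp (t * K ((x - X j \<omega>) /\<^sub>R h)))
        \<le> exp (- (?H * t * ?m)) * exp (?H * (t * ?m + t\<^sup>2 * q / 2 * exp c))"
      by (intro mult_left_mono) auto
    also have "\<dots> = exp (?H * (t\<^sup>2 * q / 2 * exp c))"
      unfolding exp_add[symmetric] by (rule arg_cong[of _ _ exp]) (simp add: algebra_simps)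
    finally show "exp (- (?H * t * ?m)) * expectation (\<lambda>\<omega>. exp (t * K ((x - X j \<omega>) /\<^sub>R h)))
        \<le> exp (?H * (t\<^sup>2 * q / 2 * exp c))" .
  qed (simp add: Bochner_Integration.integral_nonneg)
  then show ?thesis by (simp add: mult.assoc flip: exp_of_nat_mult)
qed

lemma mollify_nonneg: "(\<And>z. \<phi> z \<ge> 0) \<Longrightarrow> mollify \<phi> h x \<ge> 0"
  unfolding mollify_def using f_nonneg by (intro Bochner_Integration.integral_nonneg) simp

text \<open>Here \<open>1 + u \<ge> exp (u - u\<^sup>2)\<close> for \<open>u\<close> between 0 and
  1, which is why \<open>t\<close> is positive. As \<open>u\<close> carries a factor
  \<open>h ^ CARD('d)\<close>, the loss \<open>u\<^sup>2\<close> is of smaller order than the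
  quadratic term when the bandwidth vanishes.\<close>

lemma mgf_deviation_ge:
  fixes x :: "real^'d"
  assumes n: "n \<ge> 1" and h: "h > 0" and t: "t > 0" and c: "t * b \<le> c"
  defines "q \<equiv> mollify (\<lambda>z. (K z)\<^sup>2) h x" and "m \<equiv> mollify K h x"
  defines "u \<equiv> h ^ CARD('d) * (t * m + t\<^sup>2 * q / 2 * exp (- c))"
  assumes u: "u \<le> 1"
  shows "exp (real n * (h ^ CARD('d) * (t\<^sup>2 * q / 2 * exp (- c)) - u\<^sup>2))
    \<le> expectation (\<lambda>\<omega>. exp (real n * h ^ CARD('d) * t * deviation h n x \<omega>))"
proof -
  let ?H = "h ^ CARD('d)"
  have "m \<ge> 0" "q \<ge> 0" unfolding m_def q_def using K_nonneg by (auto intro!: mollify_nonneg)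
  then have "u \<ge> 0" unfolding u_def using h t by simp
  have "(\<Prod>j=1..n. exp (?H * (t\<^sup>2 * q / 2 * exp (- c)) - u\<^sup>2))
      \<le> expectation (\<lambda>\<omega>. exp (real n * ?H * t * deviation h n x \<omega>))"
    unfolding mgf_deviation(2)[OF n h]
  proof (intro prod_mono conjI)
    fix j assume "j \<in> {1..n}"
    have "u - u\<^sup>2 \<le> ln (1 + u)" using \<open>u \<ge> 0\<close> u by (rule ln_one_plus_pos_lower_bound)
    then have "exp (u - u\<^sup>2) \<le> 1 + u" using \<open>u \<ge> 0\<close> by (simp add: ln_ge_iff)
    also have "1 + u \<le> expectation (\<lambda>\<omega>. exp (t * K ((x - X j \<omega>) /\<^sub>R h)))"
      unfolding u_def q_def m_def using \<open>j \<in> {1..n}\<close> t c by (intro mgf_kernel(3) h) auto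
    finally have "exp (- (?H * t * m)) * exp (u - u\<^sup>2)
        \<le> exp (- (?H * t * m)) * expectation (\<lambda>\<omega>. exp (t * K ((x - X j \<omega>) /\<^sub>R h)))"
      by (intro mult_left_mono) auto
    also have "exp (- (?H * t * m)) * exp (u - u\<^sup>2) = exp (?H * (t\<^sup>2 * q / 2 * exp (- c)) - u\<^sup>2)"
      unfolding exp_add[symmetric] by (rule arg_cong[of _ _ exp]) (simp add: u_def algebra_simps)
    finally show "exp (?H * (t\<^sup>2 * q / 2 * exp (- c)) - u\<^sup>2)
        \<le> exp (- (?H * t * mollify K h x)) * expectation (\<lambda>\<omega>. exp (t * K ((x - X j \<omega>) /\<^sub>R h)))"
      unfolding m_def .
  qed simp
  then show ?thesis by (simp flip: exp_of_nat_mult)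
qed

text \<open>Chernoff's bound for both signs. The parameter \<open>t\<close> stays free: one
  application takes the nearly optimal value, the other a cruder one.\<close>

lemma prob_deviation_le:
  fixes x :: "real^'d"
  assumes n: "n \<ge> 1" and h: "h > 0" and t: "t > 0" and c: "t * b \<le> c"
  defines "q \<equiv> mollify (\<lambda>z. (K z)\<^sup>2) h x"
  shows "prob {\<omega> \<in> space M. a \<le> \<bar>deviation h n x \<omega>\<bar>}
    \<le> 2 * exp (- (real n * h ^ CARD('d) * (t * a - t\<^sup>2 * q / 2 * exp c)))"
proof -
  let ?H = "real n * h ^ CARD('d)"
  have one: "prob {\<omega> \<in> space M. a \<le> s * deviation h n x \<omega>}
      \<le> exp (- (?H * (t * a - t\<^sup>2 * q / 2 * exp c)))" if "\<bar>s\<bar> = 1" for s :: real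
  proof -
    have s2: "s\<^sup>2 = 1" using that by (metis power2_abs one_power2)
    have "prob {\<omega> \<in> space M. a \<le> s * deviation h n x \<omega>}
        \<le> exp (- (?H * t) * a) * expectation (\<lambda>\<omega>. exp (?H * (t * s) * deviation h n x \<omega>))"
      using Chernoff_ineq_ge[of "?H * t" "space M" "\<lambda>\<omega>. s * deviation h n x \<omega>" a]
        mgf_deviation(1)[OF n h, of "t * s" x] n h t
      by (simp add: set_integrable_def set_lebesgue_integral_def mult_ac indicator_times_eq_if
          cong: Bochner_Integration.integral_cong Bochner_Integration.integrable_cong)
    also have "\<dots> \<le> exp (- (?H * t) * a) * exp (?H * ((t * s)\<^sup>2 * q / 2 * exp c))"
      unfolding q_def using that t c
      by (intro mult_left_mono mgf_deviation_le[OF n h]) (auto simp: abs_mult)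
    also have "\<dots> = exp (- (?H * (t * a - t\<^sup>2 * q / 2 * exp c)))"
      unfolding exp_add[symmetric] by (rule arg_cong[of _ _ exp])
        (simp add: power_mult_distrib s2 algebra_simps)
    finally show ?thesis .
  qed
  have "{\<omega> \<in> space M. a \<le> \<bar>deviation h n x \<omega>\<bar>}
      = {\<omega> \<in> space M. a \<le> 1 * deviation h n x \<omega>} \<union> {\<omega> \<in> space M. a \<le> - 1 * deviation h n x \<omega>}"
    by (auto simp: abs_if)
  then show ?thesis
    using measure_Un_le[of "{\<omega> \<in> space M. a \<le> 1 * deviation h n x \<omega>}" M
        "{\<omega> \<in> space M. a \<le> - 1 * deviation h n x \<omega>}"] one[of 1] one[of "- 1"]
    by simp
qed

end

section \<open>Bias, second moment and regularity\<close>

context kernel_density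
begin

text \<open>\<open>g\<close> is a correction of integral 0 that may be subtracted for free: the
  first-order Taylor term for the bias, and 0 for the second moment.\<close>

lemma mollify_diff_le:
  assumes f_le: "\<And>x. f x \<le> B" and int: "integrable lborel \<phi>"
    and w: "integrable lborel w"
    and le: "\<And>z. \<bar>(f (x - h *\<^sub>R z) - f x) * \<phi> z - g z\<bar> \<le> w z"
    and g: "integrable lborel g" "(\<integral>z. g z \<partial>lborel) = 0"
  shows "\<bar>mollify \<phi> h x - f x * (\<integral>z. \<phi> z \<partial>lborel)\<bar> \<le> (\<integral>z. w z \<partial>lborel)"
proof -
  have [measurable]: "\<phi> \<in> borel_measurable borel" using int by auto
  have "integrable lborel (\<lambda>z. f (x - h *\<^sub>R z) * \<phi> z)"
  proof (rule Bochner_Integration.integrable_bound)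
    show "integrable lborel (\<lambda>z. B * \<phi> z)" using int by simp
    show "AE z in lborel. norm (f (x - h *\<^sub>R z) * \<phi> z) \<le> norm (B * \<phi> z)"
      using f_le f_nonneg order_trans[OF f_le abs_ge_self]
      by (intro AE_I2) (auto simp: abs_mult intro!: mult_right_mono)
  qed measurable
  then have eq: "mollify \<phi> h x - f x * (\<integral>z. \<phi> z \<partial>lborel)
      = (\<integral>z. (f (x - h *\<^sub>R z) - f x) * \<phi> z - g z \<partial>lborel)"
    and int': "integrable lborel (\<lambda>z. (f (x - h *\<^sub>R z) - f x) * \<phi> z - g z)"
    using int g by (simp_all add: mollify_def left_diff_distrib)
  have "\<bar>\<integral>z. (f (x - h *\<^sub>R z) - f x) * \<phi> z - g z \<partial>lborel\<bar>
      \<le> (\<integral>z. \<bar>(f (x - h *\<^sub>R z) - f x) * \<phi> z - g z\<bar> \<partial>lborel)"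
    by (rule integral_abs_bound)
  also have "\<dots> \<le> (\<integral>z. w z \<partial>lborel)"
    using int' le w by (intro integral_mono) auto
  finally show ?thesis unfolding eq .
qed

lemma bias_le:
  assumes f: "\<And>x. GDERIV f x :> grad_f x"
    and g: "\<And>x. (grad_f has_derivative blinfun_apply (D2f x)) (at x)"
    and H: "\<And>x. norm (D2f x) \<le> H" and f_le: "\<And>x. f x \<le> B"
    and int: "integrable lborel K" and one: "(\<integral>z. K z \<partial>lborel) = 1"
    and int2: "integrable lborel (\<lambda>z. (norm z)\<^sup>2 * K z)"
    and zero: "\<And>j. (\<integral>z. z $ j * K z \<partial>lborel) = 0"
  shows "\<bar>mollify K h x - f x\<bar> \<le> H * (\<integral>z. (norm z)\<^sup>2 * K z \<partial>lborel) * h\<^sup>2"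
proof -
  \<comment> \<open>Without integrability \<open>zero\<close> would carry no information, because
    the Bochner integral of a non-integrable function is 0. The domination comes from
    \<open>r \<le> 1 + r\<^sup>2\<close>, read off from the square of
    \<open>r - 1/2\<close>.\<close>
  have int1: "integrable lborel (\<lambda>z. z $ j * K z)" for j
  proof (rule Bochner_Integration.integrable_bound)
    show "integrable lborel (\<lambda>z. K z + (norm z)\<^sup>2 * K z)" using int int2 by simp
    show "AE z in lborel. norm (z $ j * K z) \<le> norm (K z + (norm z)\<^sup>2 * K z)"
    proof (intro AE_I2)
      fix z :: "real^'d"
      have "\<bar>z $ j\<bar> \<le> 1 + (norm z)\<^sup>2"
        using component_le_norm_cart[of z j] zero_le_power2[of "norm z - 1/2"]
        by (simp add: power2_diff power_divide)
      then have "\<bar>z $ j\<bar> * K z \<le> (1 + (norm z)\<^sup>2) * K z"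
        using K_nonneg by (intro mult_right_mono)
      then show "norm (z $ j * K z) \<le> norm (K z + (norm z)\<^sup>2 * K z)"
        using K_nonneg[of z] by (simp add: abs_mult distrib_right)
    qed
  qed measurable
  let ?g = "\<lambda>z. (- h *\<^sub>R z) \<bullet> grad_f x * K z"
  have g_eq: "?g = (\<lambda>z. \<Sum>j\<in>UNIV. (- h * grad_f x $ j) * (z $ j * K z))"
    by (auto simp: inner_vec_def sum_distrib_right sum_distrib_left sum_negf mult_ac)
  have "\<bar>mollify K h x - f x * (\<integral>z. K z \<partial>lborel)\<bar> \<le> (\<integral>z. (H * h\<^sup>2) * ((norm z)\<^sup>2 * K z) \<partial>lborel)"
  proof (rule mollify_diff_le[OF f_le int, where g = ?g])
    show "integrable lborel ?g" "(\<integral>z. ?g z \<partial>lborel) = 0"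
      unfolding g_eq using int1 by (simp_all add: zero)
    show "integrable lborel (\<lambda>z. (H * h\<^sup>2) * ((norm z)\<^sup>2 * K z))" using int2 by simp
    show "\<bar>(f (x - h *\<^sub>R z) - f x) * K z - ?g z\<bar> \<le> (H * h\<^sup>2) * ((norm z)\<^sup>2 * K z)" for z
    proof -
      have "\<bar>f (x + (- h *\<^sub>R z)) - f x - (- h *\<^sub>R z) \<bullet> grad_f x\<bar> * K z \<le> H * (norm (- h *\<^sub>R z))\<^sup>2 * K z"
        using K_nonneg by (intro mult_right_mono GDERIV_Taylor_bound[OF f g H])
      moreover have "\<bar>(f (x - h *\<^sub>R z) - f x) * K z - ?g z\<bar>
          = \<bar>f (x + (- h *\<^sub>R z)) - f x - (- h *\<^sub>R z) \<bullet> grad_f x\<bar> * \<bar>K z\<bar>"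
        unfolding abs_mult[symmetric] by (rule arg_cong[of _ _ abs]) (simp add: algebra_simps)
      ultimately show ?thesis using K_nonneg[of z] by (simp add: power_mult_distrib mult_ac)
    qed
  qed
  then show ?thesis unfolding one integral_mult_right_zero by (simp add: mult_ac)
qed

lemma K_square_le: "(K z)\<^sup>2 \<le> b * K z"
  using mult_right_mono[OF K_le K_nonneg, of z z] by (simp add: power2_eq_square)

lemma integrable_K_square:
  assumes "integrable lborel K"
  shows "integrable lborel (\<lambda>z. (K z)\<^sup>2)"
proof (rule Bochner_Integration.integrable_bound)
  show "integrable lborel (\<lambda>z. b * K z)" using assms by simp
  show "AE z in lborel. norm ((K z)\<^sup>2) \<le> norm (b * K z)"
    using K_square_le by (intro AE_I2) (auto intro: order_trans[OF _ abs_ge_self])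
qed measurable

text \<open>The square of \<open>K\<close> need not have centred coordinates, so the first-order
  term remains and the error is linear in \<open>h\<close>. That suffices, since \<open>hs\<close>
  is negligible compared with \<open>\<epsilon>\<close>.\<close>

lemma second_moment_le:
  assumes f: "\<And>x. GDERIV f x :> grad_f x" and G: "\<And>x. norm (grad_f x) \<le> G"
    and f_le: "\<And>x. f x \<le> B" and h: "h > 0"
    and int: "integrable lborel K" and int2: "integrable lborel (\<lambda>z. (norm z)\<^sup>2 * K z)"
  shows "\<bar>mollify (\<lambda>z. (K z)\<^sup>2) h x - f x * (\<integral>z. (K z)\<^sup>2 \<partial>lborel)\<bar>
      \<le> G * b * (\<integral>z. K z + (norm z)\<^sup>2 * K z \<partial>lborel) * h"
proof -
  have "\<bar>mollify (\<lambda>z. (K z)\<^sup>2) h x - f x * (\<integral>z. (K z)\<^sup>2 \<partial>lborel)\<bar>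
      \<le> (\<integral>z. (G * b * h) * (K z + (norm z)\<^sup>2 * K z) \<partial>lborel)"
  proof (rule mollify_diff_le[OF f_le integrable_K_square[OF int], where g = "\<lambda>_. 0"])
    show "integrable lborel (\<lambda>z. (G * b * h) * (K z + (norm z)\<^sup>2 * K z))"
      using int int2 by simp
    show "\<bar>(f (x - h *\<^sub>R z) - f x) * (K z)\<^sup>2 - 0\<bar> \<le> (G * b * h) * (K z + (norm z)\<^sup>2 * K z)" for z
    proof -
      have "G \<ge> 0" using G[of 0] norm_ge_zero order_trans by blast
      have "\<bar>f (x - h *\<^sub>R z) - f x\<bar> \<le> G * (h * norm z)"
        using GDERIV_bounded_imp_lipschitz[OF f G, of "x - h *\<^sub>R z" x] h by simp
      also have "\<dots> \<le> G * (h * (1 + (norm z)\<^sup>2))"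
        using \<open>G \<ge> 0\<close> h zero_le_power2[of "norm z - 1/2"]
        by (intro mult_left_mono) (auto simp: power2_diff power_divide)
      finally have "\<bar>f (x - h *\<^sub>R z) - f x\<bar> * (K z)\<^sup>2 \<le> G * (h * (1 + (norm z)\<^sup>2)) * (b * K z)"
        using K_square_le \<open>G \<ge> 0\<close> h by (intro mult_mono) auto
      also have "\<dots> = (G * b * h) * (K z + (norm z)\<^sup>2 * K z)"
        by (simp add: algebra_simps)
      finally show ?thesis by (simp add: abs_mult)
    qed
  qed auto
  then show ?thesis
    by (simp add: mult_ac)
qed

lemma kde_holder:
  assumes L: "\<And>x y. \<bar>K x - K y\<bar> \<le> L * dist x y powr \<alpha>" and h: "h > 0"
  shows "\<bar>kde K h X n \<omega> x - kde K h X n \<omega> y\<bar> \<le> L / h ^ CARD('d) * (dist x y / h) powr \<alpha>"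
proof (cases "n = 0")
  case True
  \<comment> \<open>For \<open>n = 0\<close> both estimators are 0 and the claim reduces to
    \<open>L \<ge> 0\<close>, which the Hoelder bound at two distinct points yields.\<close>
  have "L * dist 0 (axis undefined 1 :: real^'d) powr \<alpha> \<ge> 0"
    using L[of 0 "axis undefined 1"] by linarith
  then have "L \<ge> 0" by simp
  then show ?thesis using True h by (simp add: kde_def)
next
  case False
  have "kde K h X n \<omega> x - kde K h X n \<omega> y = 1 / (real n * h ^ CARD('d))
      * (\<Sum>j=1..n. K ((x - X j \<omega>) /\<^sub>R h) - K ((y - X j \<omega>) /\<^sub>R h))"
    by (simp add: kde_def sum_subtractf right_diff_distrib)
  also have "\<bar>\<dots>\<bar> = 1 / (real n * h ^ CARD('d))
      * \<bar>\<Sum>j=1..n. K ((x - X j \<omega>) /\<^sub>R h) - K ((y - X j \<omega>) /\<^sub>R h)\<bar>"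
    using h by (simp add: abs_mult)
  also have "\<dots> \<le> 1 / (real n * h ^ CARD('d)) * (\<Sum>j=1..n. L * (dist x y / h) powr \<alpha>)"
  proof (intro mult_left_mono order_trans[OF sum_abs] sum_mono)
    fix j
    have "dist ((x - X j \<omega>) /\<^sub>R h) ((y - X j \<omega>) /\<^sub>R h) = dist x y / h"
      using h by (simp add: dist_norm divide_inverse mult.commute flip: scaleR_diff_right)
    then show "\<bar>K ((x - X j \<omega>) /\<^sub>R h) - K ((y - X j \<omega>) /\<^sub>R h)\<bar> \<le> L * (dist x y / h) powr \<alpha>"
      using L by metis
  qed (use h in auto)
  also have "\<dots> = L / h ^ CARD('d) * (dist x y / h) powr \<alpha>"
    using False by simp
  finally show ?thesis .
qed

lemma kde_continuous: "continuous_on S (kde K h X n \<omega>)"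
  unfolding kde_def
  by (intro continuous_intros continuous_on_compose2[OF K_cont]) auto

end

text \<open>A cubic lattice of step \<open>\<rho>\<close>, with distances estimated by the l1 norm;
  hence the factor \<open>CARD('d)\<close>. Grid points may fall outside \<open>C\<close>, so the
  deviation bounds have to hold at every point of the space.\<close>

lemma grid_cover:
  fixes C :: "(real^'d) set"
  assumes "bounded C"
  shows "\<exists>A\<ge>1. \<forall>\<rho>\<in>{0<..1}. \<exists>G. finite G \<and> real (card G) \<le> (A / \<rho>) ^ CARD('d)
    \<and> (\<forall>x\<in>C. \<exists>y\<in>G. dist x y \<le> real CARD('d) * \<rho>)"
proof -
  obtain R where R: "R > 0" "\<And>x. x \<in> C \<Longrightarrow> norm x \<le> R"
    using assms bounded_pos by blast
  show ?thesis
  \<comment> \<open>Each coordinate takes \<open>2 * m + 1 \<le> 2 * R / \<rho> + 3\<close> values,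
    and \<open>\<rho> \<le> 1\<close> turns this into \<open>(2 * R + 3) / \<rho>\<close>.\<close>
  proof (intro exI[of _ "2 * R + 3"] conjI ballI)
    fix \<rho> :: real assume \<rho>: "\<rho> \<in> {0<..1}"
    define m where "m = \<lceil>R / \<rho>\<rceil>"
    have m: "m \<ge> 0" "of_int m \<le> R / \<rho> + 1" "R / \<rho> \<le> of_int m"
      using less_trans[OF _ divide_pos_pos, of "- 1" R \<rho>] R(1) \<rho> by (auto simp: m_def)
    define P where "P = (PiE UNIV (\<lambda>_::'d. {- m..m}))"
    define G where "G = (\<lambda>k. \<chi> i. \<rho> * of_int (k i)) ` P"
    show "\<exists>G. finite G \<and> real (card G) \<le> ((2 * R + 3) / \<rho>) ^ CARD('d)
        \<and> (\<forall>x\<in>C. \<exists>y\<in>G. dist x y \<le> real CARD('d) * \<rho>)"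
    proof (intro exI[of _ G] conjI ballI)
      have fin: "finite P" by (auto simp: P_def intro: finite_PiE)
      then show "finite G" by (simp add: G_def)
      have "card G \<le> card P" unfolding G_def using fin by (rule card_image_le)
      also have "card P = nat (2 * m + 1) ^ CARD('d)"
        using m(1) by (simp add: P_def card_PiE)
      finally have "real (card G) \<le> real (nat (2 * m + 1)) ^ CARD('d)"
        by (metis of_nat_le_iff of_nat_power)
      also have "\<dots> \<le> ((2 * R + 3) / \<rho>) ^ CARD('d)"
      proof (intro power_mono)
        have "real (nat (2 * m + 1)) = 2 * of_int m + 1" using m(1) by simp
        also have "\<dots> \<le> 2 * (R / \<rho>) + 3" using m(2) by simp
        also have "\<dots> \<le> (2 * R + 3) / \<rho>" using \<rho> by (simp add: field_simps)
        finally show "real (nat (2 * m + 1)) \<le> (2 * R + 3) / \<rho>" .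
      qed simp
      finally show "real (card G) \<le> ((2 * R + 3) / \<rho>) ^ CARD('d)" .
      fix x assume "x \<in> C"
      define k where "k = (\<lambda>i. \<lfloor>x $ i / \<rho>\<rfloor>)"
      have "k \<in> P"
      proof -
        have "- m \<le> k i \<and> k i \<le> m" for i
        proof -
          have "\<bar>x $ i\<bar> \<le> R" using component_le_norm_cart[of x i] R(2)[OF \<open>x \<in> C\<close>] by linarith
          then have "- (R / \<rho>) \<le> x $ i / \<rho>" "x $ i / \<rho> \<le> R / \<rho>"
            using \<rho> by (auto simp: field_simps abs_le_iff)
          then show ?thesis using m(3) unfolding k_def
            by (auto simp: le_floor_iff) linarith
        qed
        then show ?thesis by (auto simp: P_def)
      qed
      moreover have "dist x (\<chi> i. \<rho> * of_int (k i)) \<le> real CARD('d) * \<rho>"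
      proof -
        have "\<bar>(x - (\<chi> i. \<rho> * of_int (k i))) $ i\<bar> \<le> \<rho>" for i
        proof -
          have "of_int (k i) \<le> x $ i / \<rho>" "x $ i / \<rho> \<le> of_int (k i) + 1"
            unfolding k_def by linarith+
          then show ?thesis using \<rho> by (auto simp: field_simps abs_le_iff)
        qed
        then have "(\<Sum>i\<in>UNIV. \<bar>(x - (\<chi> i. \<rho> * of_int (k i))) $ i\<bar>) \<le> (\<Sum>i\<in>(UNIV::'d set). \<rho>)"
          by (intro sum_mono)
        then show ?thesis
          using norm_le_l1_cart[of "x - (\<chi> i. \<rho> * of_int (k i))"] by (simp add: dist_norm)
      qed
      ultimately show "\<exists>y\<in>G. dist x y \<le> real CARD('d) * \<rho>"
        unfolding G_def by blast
    qed
  qed (use R in simp)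
qed

section \<open>Deviation probabilities in the asymptotic regime\<close>

text \<open>The smoothness of \<open>f\<close> and the moments of \<open>K\<close> enter only
  through their consequences \<open>bias\<close>, \<open>second_moment\<close> and
  \<open>f_lipschitz\<close>; \<open>\<kappa>\<close> is characterised by
  \<open>second_moment\<close>.\<close>

locale confidence_band = kernel_density M X f K b
  for M :: "'w measure" and X :: "nat \<Rightarrow> 'w \<Rightarrow> real^'d" and f K b +
  fixes \<kappa> B c\<^sub>1 c\<^sub>2 G L \<alpha> :: real and h hs v \<epsilon> :: "nat \<Rightarrow> real"
  assumes \<kappa>_pos: "\<kappa> > 0"
    and f_le: "\<And>x. f x \<le> B"
    and bias: "\<And>k x. \<bar>mollify K k x - f x\<bar> \<le> c\<^sub>1 * k\<^sup>2"
    and second_moment: "\<And>k x. k > 0 \<Longrightarrow> \<bar>mollify (\<lambda>z. (K z)\<^sup>2) k x - f x * \<kappa>\<bar> \<le> c\<^sub>2 * k"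
    and c\<^sub>2_nonneg: "c\<^sub>2 \<ge> 0"
    and K_holder: "\<And>x y. \<bar>K x - K y\<bar> \<le> L * dist x y powr \<alpha>"
    and \<alpha>: "0 < \<alpha>" and L_nonneg: "L \<ge> 0"
    and f_lipschitz: "\<And>x y. \<bar>f x - f y\<bar> \<le> G * dist x y" and G_nonneg: "G \<ge> 0"
    and h_pos: "\<And>n. n \<ge> 1 \<Longrightarrow> h n > 0" and h_lim: "h \<longlonglongrightarrow> 0"
    and hs_pos: "\<And>n. n \<ge> 1 \<Longrightarrow> hs n > 0" and hs_lim: "hs \<longlonglongrightarrow> 0"
    and v_pos: "\<And>n. n \<ge> 1 \<Longrightarrow> v n > 0" and v_lim: "filterlim v at_top sequentially"
    and \<epsilon>_pos: "\<And>n. n \<ge> 1 \<Longrightarrow> \<epsilon> n > 0" and \<epsilon>_lim: "\<epsilon> \<longlonglongrightarrow> 0"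
    and hs_\<epsilon>: "(\<lambda>n. hs n / \<epsilon> n) \<longlonglongrightarrow> 0"
    and h2_\<epsilon>: "(\<lambda>n. (h n)\<^sup>2 / \<epsilon> n) \<longlonglongrightarrow> 0"
    and v_\<epsilon>: "filterlim (\<lambda>n. v n * \<epsilon> n powr (3/2)) at_top sequentially"
    and v_hs2: "(\<lambda>n. v n * (hs n)\<^sup>2 / sqrt (\<epsilon> n)) \<longlonglongrightarrow> 0"
    and rate_log: "filterlim (\<lambda>n. real n * hs n ^ CARD('d) / ((v n)\<^sup>2 * ln (1 / hs n))) at_top sequentially"
    and rate_h: "filterlim (\<lambda>n. (v n)\<^sup>2 * h n ^ CARD('d) * (\<epsilon> n)\<^sup>2 / hs n ^ CARD('d)) at_top sequentially"
begin

section \<open>The speed \<open>N\<close> and comparisons between the rates\<close>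

definition N :: "nat \<Rightarrow> real" where
  "N n = real n * hs n ^ CARD('d) / (v n)\<^sup>2"

lemma eventually_pos: "\<forall>\<^sub>F n in sequentially. n \<ge> 1 \<and> h n > 0 \<and> hs n > 0 \<and> v n > 0 \<and> \<epsilon> n > 0 \<and> N n > 0"
  using eventually_ge_at_top[of "1::nat"]
proof eventually_elim
  case (elim n)
  then have "N n > 0" unfolding N_def using hs_pos[of n] v_pos[of n] by (intro divide_pos_pos mult_pos_pos) auto
  then show ?case using h_pos hs_pos v_pos \<epsilon>_pos elim by auto
qed

lemma eventually_less:
  fixes u :: "nat \<Rightarrow> real"
  assumes "u \<longlonglongrightarrow> 0" "a > 0"
  shows "\<forall>\<^sub>F n in sequentially. u n < a"
  using order_tendstoD(2)[OF assms] .

text \<open>This makes the Chernoff parameter of \<open>prob_deviation_hs_le\<close> tend to 0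
  uniformly, its largest values occurring where \<open>f \<le> \<epsilon> n\<close>.\<close>

lemma v_sqrt_\<epsilon>: "filterlim (\<lambda>n. v n * sqrt (\<epsilon> n)) at_top sequentially"
proof (rule filterlim_at_top_mono[OF v_\<epsilon>])
  show "\<forall>\<^sub>F n in sequentially. v n * \<epsilon> n powr (3/2) \<le> v n * sqrt (\<epsilon> n)"
    using eventually_pos eventually_less[OF \<epsilon>_lim zero_less_one]
    by eventually_elim (auto simp: powr_mono' simp flip: powr_half_sqrt)
qed

lemma ln_inverse_hs_over_N: "(\<lambda>n. ln (1 / hs n) / N n) \<longlonglongrightarrow> 0"
proof -
  have "(\<lambda>n. inverse (real n * hs n ^ CARD('d) / ((v n)\<^sup>2 * ln (1 / hs n)))) \<longlonglongrightarrow> 0"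
    by (rule tendsto_inverse_0_at_top[OF rate_log])
  then show ?thesis by (simp add: N_def mult_ac)
qed

lemma N_lim: "filterlim N at_top sequentially"
proof (rule filterlim_at_top_mono[OF rate_log])
  show "\<forall>\<^sub>F n in sequentially. real n * hs n ^ CARD('d) / ((v n)\<^sup>2 * ln (1 / hs n)) \<le> N n"
    \<comment> \<open>Below \<open>exp (- 1)\<close> the logarithm \<open>ln (1 / hs n)\<close> is
      at least 1, so removing it from the denominator only increases the quotient.\<close>
    using eventually_pos eventually_less[OF hs_lim, of "exp (- 1)", simplified]
  proof eventually_elim
    case (elim n)
    then have "ln (hs n) < ln (exp (- 1))" by (subst ln_less_cancel_iff) auto
    then have "ln (1 / hs n) \<ge> 1" using elim by (simp add: ln_div)
    moreover have "hs n < 1" using elim less_trans[of "hs n" "exp (- 1)" 1] by simp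
    ultimately have "N n / ln (1 / hs n) \<le> N n / 1" using elim by (intro divide_left_mono) auto
    then show ?case by (simp add: N_def)
  qed
qed

lemma eventually_N_gt: "\<forall>\<^sub>F n in sequentially. N n > c"
  using N_lim by (simp add: filterlim_at_top_dense)

text \<open>As \<open>h\<close>, \<open>\<epsilon>\<close> and \<open>1 / v\<close> are bounded below by powers of \<open>hs\<close>, a grid of mesh a power of \<open>hs\<close>
  is fine enough and the logarithm of its cardinality is negligible compared with \<open>N\<close>.\<close>

lemma eventually_polynomial:
  "\<forall>\<^sub>F n in sequentially. hs n < 1 \<and> h n < 1 \<and> \<epsilon> n < 1 \<and> hs n \<le> \<epsilon> n
    \<and> hs n ^ 3 \<le> sqrt (\<epsilon> n) / v n \<and> v n * (hs n)\<^sup>2 \<le> 1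
    \<and> hs n ^ (CARD('d) + 4) \<le> h n \<and> hs n ^ (CARD('d) + 4) \<le> h n ^ CARD('d)"
  using eventually_pos eventually_less[OF h_lim zero_less_one] eventually_less[OF hs_lim zero_less_one]
    eventually_less[OF \<epsilon>_lim zero_less_one] eventually_less[OF hs_\<epsilon> zero_less_one]
    eventually_less[OF v_hs2 zero_less_one]
    filterlim_at_top_dense[THEN iffD1, OF rate_h, rule_format, of 1]
proof eventually_elim
  case (elim n)
  have hs: "hs n \<le> \<epsilon> n" using elim by (simp add: divide_less_eq)
  have "sqrt (\<epsilon> n) \<le> 1" using elim by simp
  have "v n * (hs n)\<^sup>2 < sqrt (\<epsilon> n)" using elim by (simp add: divide_less_eq)
  with \<open>sqrt (\<epsilon> n) \<le> 1\<close> have v: "v n * (hs n)\<^sup>2 \<le> 1" by linarith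
  have "hs n \<le> sqrt (hs n)" using elim by (intro real_le_rsqrt) (auto simp: power2_eq_square mult_left_le)
  also have "\<dots> \<le> sqrt (\<epsilon> n)" using hs by simp
  finally have "hs n * (v n * (hs n)\<^sup>2) \<le> sqrt (\<epsilon> n) * 1"
    using v elim by (intro mult_mono) auto
  then have 3: "hs n ^ 3 \<le> sqrt (\<epsilon> n) / v n"
    using elim by (simp add: pos_le_divide_eq power2_eq_square power3_eq_cube mult_ac)
  \<comment> \<open>\<open>rate_h\<close> bounds \<open>hs n ^ CARD('d)\<close> by a multiple of
    \<open>(v n)\<^sup>2\<close>; four more powers of \<open>hs n\<close> turn that factor into the
    square of \<open>v n * (hs n)\<^sup>2 \<le> 1\<close>. This is the origin of the exponent
    \<open>CARD('d) + 4\<close>.\<close>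
  have "hs n ^ CARD('d) * hs n ^ 4 \<le> ((v n)\<^sup>2 * h n ^ CARD('d) * (\<epsilon> n)\<^sup>2) * hs n ^ 4"
    using elim by (intro mult_right_mono) (auto simp: less_divide_eq)
  also have "\<dots> = h n ^ CARD('d) * ((v n * (hs n)\<^sup>2)\<^sup>2 * (\<epsilon> n)\<^sup>2)"
    by (simp add: power_mult_distrib flip: power_mult)
  also have "\<dots> \<le> h n ^ CARD('d) * (1\<^sup>2 * 1\<^sup>2)"
    using v elim by (intro mult_left_mono mult_mono power_mono) auto
  finally have w: "hs n ^ (CARD('d) + 4) \<le> h n ^ CARD('d)" by (simp add: power_add)
  also have "\<dots> \<le> h n ^ 1" using elim by (intro power_decreasing) (auto simp: Suc_leI)
  finally show ?case using elim hs v 3 w by simp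
qed

text \<open>The sharp bound. Uniformity in \<open>x\<close> rests on the cancellation of
  \<open>max (f x) (\<epsilon> n)\<close> between threshold and variance, with the remaining errors
  controlled by the floor \<open>\<epsilon> n\<close>.\<close>

lemma prob_deviation_hs_le:
  assumes \<gamma>: "\<gamma> > 0" and "\<eta> > 0"
  shows "\<forall>\<^sub>F n in sequentially. \<forall>x.
    prob {\<omega> \<in> space M. \<gamma> * sqrt (\<kappa> * max (f x) (\<epsilon> n)) / v n \<le> \<bar>deviation (hs n) n x \<omega>\<bar>}
      \<le> 2 * exp (- (N n * (\<gamma>\<^sup>2 / 2 - \<eta>)))"
proof -
  \<comment> \<open>\<open>c n\<close> bounds the exponent \<open>t * b\<close> and
    \<open>r n\<close> the relative error of the second moment, both independently of
    \<open>x\<close>.\<close>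
  define c where "c = (\<lambda>n. b * \<gamma> / sqrt \<kappa> * inverse (v n * sqrt (\<epsilon> n)))"
  define r where "r = (\<lambda>n. c\<^sub>2 / \<kappa> * (hs n / \<epsilon> n))"
  have "c \<longlonglongrightarrow> 0"
    unfolding c_def by (rule tendsto_mult_right_zero[OF tendsto_inverse_0_at_top[OF v_sqrt_\<epsilon>]])
  moreover have "r \<longlonglongrightarrow> 0" unfolding r_def by (rule tendsto_mult_right_zero[OF hs_\<epsilon>])
  ultimately have "(\<lambda>n. \<gamma>\<^sup>2 * (1 - (1 + r n) * exp (c n) / 2)) \<longlonglongrightarrow> \<gamma>\<^sup>2 * (1 - (1 + 0) * exp 0 / 2)"
    by (intro tendsto_intros) auto
  moreover have "\<gamma>\<^sup>2 / 2 - \<eta> < \<gamma>\<^sup>2 * (1 - (1 + 0) * exp 0 / 2)" using \<open>\<eta> > 0\<close> by simp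
  ultimately have "\<forall>\<^sub>F n in sequentially. \<gamma>\<^sup>2 / 2 - \<eta> < \<gamma>\<^sup>2 * (1 - (1 + r n) * exp (c n) / 2)"
    by (rule order_tendstoD(1))
  with eventually_pos show ?thesis
  proof eventually_elim
    case (elim n)
    show ?case
    proof
      fix x
      define m where "m = max (f x) (\<epsilon> n)"
      \<comment> \<open>The threshold divided by the approximate variance
        \<open>\<kappa> * m\<close>, that is, the minimiser of the Gaussian Chernoff
        exponent.\<close>
      define t where "t = \<gamma> / (v n * sqrt (\<kappa> * m))"
      define q where "q = mollify (\<lambda>z. (K z)\<^sup>2) (hs n) x"
      have m: "m > 0" "m \<ge> \<epsilon> n" "m \<ge> f x" using elim by (auto simp: m_def)
      have "t > 0" using m \<gamma> \<kappa>_pos elim by (simp add: t_def)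
      have "t \<le> \<gamma> / (v n * sqrt (\<kappa> * \<epsilon> n))"
        unfolding t_def using m \<gamma> \<kappa>_pos elim by (intro divide_left_mono) auto
      then have "t * b \<le> \<gamma> / (v n * sqrt (\<kappa> * \<epsilon> n)) * b"
        using b_nonneg by (intro mult_right_mono)
      also have "\<dots> = c n" by (simp add: c_def real_sqrt_mult divide_inverse mult_ac)
      finally have tb: "t * b \<le> c n" .
      have t2: "t\<^sup>2 * (\<kappa> * m) = \<gamma>\<^sup>2 / (v n)\<^sup>2"
        using m \<kappa>_pos elim by (simp add: t_def power_divide power_mult_distrib)
      have ta: "t * (\<gamma> * sqrt (\<kappa> * m) / v n) = \<gamma>\<^sup>2 / (v n)\<^sup>2"
        using m \<kappa>_pos elim by (simp add: t_def power2_eq_square)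
      have "r n \<ge> 0" using c\<^sub>2_nonneg \<kappa>_pos elim by (simp add: r_def)
      have "q \<le> f x * \<kappa> + c\<^sub>2 * hs n"
        using second_moment[of "hs n" x] elim by (auto simp: q_def abs_le_iff)
      also have "c\<^sub>2 * hs n = \<kappa> * \<epsilon> n * r n" using \<kappa>_pos elim by (simp add: r_def)
      also have "f x * \<kappa> + \<dots> \<le> m * \<kappa> + \<kappa> * m * r n"
        using m \<open>r n \<ge> 0\<close> \<kappa>_pos by (intro add_mono mult_right_mono mult_left_mono) auto
      finally have "q \<le> \<kappa> * m * (1 + r n)" by (simp add: algebra_simps)
      then have "t\<^sup>2 * q / 2 * exp (c n) \<le> t\<^sup>2 * (\<kappa> * m * (1 + r n)) / 2 * exp (c n)"
        by (intro mult_right_mono divide_right_mono mult_left_mono) auto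
      also have "\<dots> = \<gamma>\<^sup>2 / (v n)\<^sup>2 * ((1 + r n) * exp (c n) / 2)"
        unfolding t2[symmetric] by (simp add: mult_ac)
      finally have "\<gamma>\<^sup>2 / (v n)\<^sup>2 * (1 - (1 + r n) * exp (c n) / 2)
          \<le> t * (\<gamma> * sqrt (\<kappa> * m) / v n) - t\<^sup>2 * q / 2 * exp (c n)"
        unfolding ta by (simp add: algebra_simps)
      then have "real n * hs n ^ CARD('d) * (\<gamma>\<^sup>2 / (v n)\<^sup>2 * (1 - (1 + r n) * exp (c n) / 2))
          \<le> real n * hs n ^ CARD('d) * (t * (\<gamma> * sqrt (\<kappa> * m) / v n) - t\<^sup>2 * q / 2 * exp (c n))"
        using elim by (intro mult_left_mono) auto
      moreover have "N n * (\<gamma>\<^sup>2 / 2 - \<eta>) \<le> N n * (\<gamma>\<^sup>2 * (1 - (1 + r n) * exp (c n) / 2))"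
        using elim by (intro mult_left_mono) auto
      ultimately have "N n * (\<gamma>\<^sup>2 / 2 - \<eta>)
          \<le> real n * hs n ^ CARD('d) * (t * (\<gamma> * sqrt (\<kappa> * m) / v n) - t\<^sup>2 * q / 2 * exp (c n))"
        by (simp add: N_def)
      then show "prob {\<omega> \<in> space M. \<gamma> * sqrt (\<kappa> * max (f x) (\<epsilon> n)) / v n \<le> \<bar>deviation (hs n) n x \<omega>\<bar>}
          \<le> 2 * exp (- (N n * (\<gamma>\<^sup>2 / 2 - \<eta>)))"
        using prob_deviation_le[OF _ _ \<open>t > 0\<close> tb, of n "hs n" "\<gamma> * sqrt (\<kappa> * m) / v n" x] elim
        unfolding m_def q_def by (auto elim!: order_trans)
    qed
  qed
qed

text \<open>The exponent is of order
  \<open>real n * h n ^ CARD('d) * (\<epsilon> n)\<^sup>2\<close>, and its ratio to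
  \<open>N n\<close> is exactly the quantity in \<open>rate_h\<close>. It therefore beats any
  multiple \<open>R\<close> of \<open>N n\<close>, and the constants may be crude.\<close>

lemma prob_deviation_h_le:
  assumes \<eta>: "\<eta> > 0" and "R > 0"
  shows "\<forall>\<^sub>F n in sequentially. \<forall>x.
    prob {\<omega> \<in> space M. \<eta> * \<epsilon> n \<le> \<bar>deviation (h n) n x \<omega>\<bar>} \<le> 2 * exp (- (N n * R))"
proof -
  define Q where "Q = \<kappa> * B + c\<^sub>2 + 1"
  have "B \<ge> 0" using f_le[of 0] f_nonneg[of 0] by linarith
  then have "Q > 0" using \<kappa>_pos c\<^sub>2_nonneg by (simp add: Q_def add_nonneg_pos)
  \<comment> \<open>\<open>Q\<close> bounds the second moment at bandwidth \<open>h n\<close>. The 1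
    keeps the Chernoff parameter \<open>s * \<epsilon> n\<close> below 1; the other bound makes the
    quadratic cost at most half the linear gain.\<close>
  define s where "s = min 1 (\<eta> / (Q * exp b))"
  have s: "s > 0" "s \<le> 1" "s * (Q * exp b) \<le> \<eta>"
    using \<eta> \<open>Q > 0\<close> min.cobounded2[of 1 "\<eta> / (Q * exp b)"] by (auto simp: s_def pos_le_divide_eq[symmetric])
  show ?thesis
    using eventually_pos eventually_polynomial
      filterlim_at_top_dense[THEN iffD1, OF rate_h, rule_format, of "2 * R / (s * \<eta>)"]
  proof eventually_elim
    case (elim n)
    show ?case
    proof
      fix x
      define t where "t = s * \<epsilon> n"
      define q where "q = mollify (\<lambda>z. (K z)\<^sup>2) (h n) x"
      have "t > 0" using s elim by (simp add: t_def)
      have "t \<le> 1" unfolding t_def using s elim by (intro mult_le_one) auto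
      then have tb: "t * b \<le> b" using b_nonneg by (simp add: mult_left_le_one_le \<open>t > 0\<close> less_imp_le)
      have "q \<le> f x * \<kappa> + c\<^sub>2 * h n"
        using second_moment[of "h n" x] elim by (auto simp: q_def abs_le_iff)
      also have "\<dots> \<le> B * \<kappa> + c\<^sub>2 * 1"
        using f_le \<kappa>_pos c\<^sub>2_nonneg elim by (intro add_mono mult_right_mono mult_left_mono) auto
      finally have "q \<le> Q" by (simp add: Q_def mult_ac)
      then have "t\<^sup>2 * q / 2 * exp b \<le> t\<^sup>2 * Q / 2 * exp b"
        by (intro mult_right_mono divide_right_mono mult_left_mono) auto
      also have "\<dots> = t * \<epsilon> n / 2 * (s * (Q * exp b))" by (simp add: t_def power2_eq_square)
      also have "\<dots> \<le> t * \<epsilon> n / 2 * \<eta>"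
        using s \<open>t > 0\<close> elim by (intro mult_left_mono) auto
      finally have "s * \<eta> / 2 * (\<epsilon> n)\<^sup>2 \<le> t * (\<eta> * \<epsilon> n) - t\<^sup>2 * q / 2 * exp b"
        by (simp add: t_def power2_eq_square algebra_simps)
      then have "real n * h n ^ CARD('d) * (s * \<eta> / 2 * (\<epsilon> n)\<^sup>2)
          \<le> real n * h n ^ CARD('d) * (t * (\<eta> * \<epsilon> n) - t\<^sup>2 * q / 2 * exp b)"
        using elim by (intro mult_left_mono) auto
      moreover have "N n * (2 * R / (s * \<eta>)) \<le> N n * ((v n)\<^sup>2 * h n ^ CARD('d) * (\<epsilon> n)\<^sup>2 / hs n ^ CARD('d))"
        using elim by (intro mult_left_mono) auto
      then have "N n * (2 * R / (s * \<eta>)) * (s * \<eta> / 2)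
          \<le> N n * ((v n)\<^sup>2 * h n ^ CARD('d) * (\<epsilon> n)\<^sup>2 / hs n ^ CARD('d)) * (s * \<eta> / 2)"
        using s \<eta> by (intro mult_right_mono) auto
      then have "N n * R \<le> real n * h n ^ CARD('d) * (s * \<eta> / 2 * (\<epsilon> n)\<^sup>2)"
        using s \<eta> elim by (simp add: N_def mult_ac)
      ultimately have "N n * R \<le> real n * h n ^ CARD('d) * (t * (\<eta> * \<epsilon> n) - t\<^sup>2 * q / 2 * exp b)"
        by linarith
      then show "prob {\<omega> \<in> space M. \<eta> * \<epsilon> n \<le> \<bar>deviation (h n) n x \<omega>\<bar>} \<le> 2 * exp (- (N n * R))"
        using prob_deviation_le[OF _ _ \<open>t > 0\<close> tb, of n "h n" "\<eta> * \<epsilon> n" x] elim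
        unfolding q_def by (auto elim!: order_trans)
    qed
  qed
qed

lemma prob_deviation_hs_ge:
  assumes F: "f x > 0" and "\<tau> \<ge> 0" "\<eta> > 0"
  shows "\<forall>\<^sub>F n in sequentially. exp (- (N n * (\<tau>\<^sup>2 / (2 * (f x * \<kappa>)) + \<eta>)))
    \<le> prob {\<omega> \<in> space M. v n * deviation (hs n) n x \<omega> > \<tau>}"
proof (rule Gaertner_Ellis_Gaussian_lower_bound[where s = "f x * \<kappa>", OF _ N_lim])
  have scale: "N n * t * (v n * D) = real n * hs n ^ CARD('d) * (t / v n) * D" if "v n > 0" for n t D
    using that by (simp add: N_def power2_eq_square)
  define m where "m = (\<lambda>n. mollify K (hs n) x)"
  define q where "q = (\<lambda>n. mollify (\<lambda>z. (K z)\<^sup>2) (hs n) x)"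
  define c where "c = (\<lambda>t n. \<bar>t\<bar> * b * inverse (v n))"
  have c: "c t \<longlonglongrightarrow> 0" for t
    unfolding c_def by (rule tendsto_mult_right_zero[OF tendsto_inverse_0_at_top[OF v_lim]])
  have q: "q \<longlonglongrightarrow> f x * \<kappa>"
  proof (rule Lim_null_comparison[OF _ tendsto_mult_right_zero[OF hs_lim, of c\<^sub>2], THEN LIM_zero_cancel])
    show "\<forall>\<^sub>F n in sequentially. norm (q n - f x * \<kappa>) \<le> c\<^sub>2 * hs n"
      using eventually_pos by eventually_elim (auto simp: q_def intro: second_moment)
  qed
  have m: "m \<longlonglongrightarrow> f x"
  proof (rule Lim_null_comparison[where g = "\<lambda>n. c\<^sub>1 * (hs n)\<^sup>2", THEN LIM_zero_cancel])
    show "\<forall>\<^sub>F n in sequentially. norm (m n - f x) \<le> c\<^sub>1 * (hs n)\<^sup>2"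
      unfolding m_def real_norm_def by (intro always_eventually allI bias)
    show "(\<lambda>n. c\<^sub>1 * (hs n)\<^sup>2) \<longlonglongrightarrow> 0"
      using tendsto_power[OF hs_lim, of 2] by (intro tendsto_mult_right_zero) simp
  qed
  show "(\<lambda>\<omega>. v n * deviation (hs n) n x \<omega>) \<in> borel_measurable M" for n by measurable
  show "\<forall>\<^sub>F n in sequentially. \<forall>t. integrable M (\<lambda>\<omega>. exp (N n * t * (v n * deviation (hs n) n x \<omega>)))"
    using eventually_pos by eventually_elim (simp only: scale mgf_deviation(1) simp_thms)
  show "f x * \<kappa> > 0" using F \<kappa>_pos by simp
  show "\<forall>\<^sub>F n in sequentially. expectation (\<lambda>\<omega>. exp (N n * t * (v n * deviation (hs n) n x \<omega>)))
      \<le> exp (N n * (t\<^sup>2 * (f x * \<kappa>) / 2 + \<eta>))" if "\<eta> > 0" for t \<eta>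
  proof -
    have "(\<lambda>n. t\<^sup>2 * q n / 2 * exp (c t n)) \<longlonglongrightarrow> t\<^sup>2 * (f x * \<kappa>) / 2 * exp 0"
      using q c by (intro tendsto_intros) auto
    then have "\<forall>\<^sub>F n in sequentially. t\<^sup>2 * q n / 2 * exp (c t n) < t\<^sup>2 * (f x * \<kappa>) / 2 + \<eta>"
      by (rule order_tendstoD(2)) (use that in simp)
    with eventually_pos show ?thesis
    proof eventually_elim
      case (elim n)
      then have n: "n \<ge> 1" "hs n > 0" "v n > 0" by auto
      have tb: "\<bar>t / v n\<bar> * b \<le> c t n"
        using n by (simp add: c_def divide_inverse abs_mult)
      have "expectation (\<lambda>\<omega>. exp (N n * t * (v n * deviation (hs n) n x \<omega>)))
          \<le> exp (real n * hs n ^ CARD('d) * ((t / v n)\<^sup>2 * q n / 2 * exp (c t n)))"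
        unfolding scale[OF n(3)] q_def by (rule mgf_deviation_le[OF n(1,2) tb])
      also have "\<dots> = exp (N n * (t\<^sup>2 * q n / 2 * exp (c t n)))"
        by (rule arg_cong[of _ _ exp]) (simp add: N_def power_divide)
      also have "\<dots> \<le> exp (N n * (t\<^sup>2 * (f x * \<kappa>) / 2 + \<eta>))"
        using elim by (simp add: less_imp_le)
      finally show ?case .
    qed
  qed
  show "\<forall>\<^sub>F n in sequentially. exp (N n * (t\<^sup>2 * (f x * \<kappa>) / 2 - \<eta>))
      \<le> expectation (\<lambda>\<omega>. exp (N n * t * (v n * deviation (hs n) n x \<omega>)))" if "t > 0" "\<eta> > 0" for t \<eta>
  proof -
    let ?H = "\<lambda>n. hs n ^ CARD('d)"
    \<comment> \<open>With tilt \<open>t / v n\<close>, the quantity \<open>u\<close> of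
      \<open>mgf_deviation_ge\<close> is \<open>?H n * ?w n / v n\<close>. Its total loss
      \<open>real n * u\<^sup>2\<close> equals \<open>N n * ?H n * (?w n)\<^sup>2\<close>, which is
      o(N) because \<open>?H\<close> tends to 0 and \<open>?w\<close> converges.\<close>
    let ?w = "\<lambda>n. t * m n + t\<^sup>2 * inverse (v n) * q n / 2 * exp (- c t n)"
    have H: "?H \<longlonglongrightarrow> 0"
      using tendsto_power[OF hs_lim, of "CARD('d)"] by (simp add: zero_power)
    have vi: "(\<lambda>n. inverse (v n)) \<longlonglongrightarrow> 0" by (rule tendsto_inverse_0_at_top[OF v_lim])
    have w: "?w \<longlonglongrightarrow> t * f x + t\<^sup>2 * 0 * (f x * \<kappa>) / 2 * exp (- 0)"
      using q c m vi by (intro tendsto_intros) auto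
    have "(\<lambda>n. t\<^sup>2 * q n / 2 * exp (- c t n) - ?H n * (?w n)\<^sup>2)
        \<longlonglongrightarrow> t\<^sup>2 * (f x * \<kappa>) / 2 * exp (- 0) - 0 * (t * f x + t\<^sup>2 * 0 * (f x * \<kappa>) / 2 * exp (- 0))\<^sup>2"
      by (intro tendsto_diff tendsto_mult tendsto_power w H tendsto_divide tendsto_exp tendsto_minus q c) auto
    then have ev: "\<forall>\<^sub>F n in sequentially. t\<^sup>2 * (f x * \<kappa>) / 2 - \<eta> < t\<^sup>2 * q n / 2 * exp (- c t n) - ?H n * (?w n)\<^sup>2"
      using that by (intro order_tendstoD(1)) auto
    have "(\<lambda>n. ?H n * (inverse (v n) * ?w n)) \<longlonglongrightarrow> 0 * (0 * (t * f x + t\<^sup>2 * 0 * (f x * \<kappa>) / 2 * exp (- 0)))"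
      by (intro tendsto_mult H vi w)
    then have "\<forall>\<^sub>F n in sequentially. ?H n * (inverse (v n) * ?w n) < 1"
      by (rule order_tendstoD(2)) simp
    with eventually_pos ev show ?thesis
    proof eventually_elim
      case (elim n)
      then have n: "n \<ge> 1" "hs n > 0" "v n > 0" by auto
      have u: "?H n * (t / v n * m n + (t / v n)\<^sup>2 * q n / 2 * exp (- c t n)) = ?H n * (inverse (v n) * ?w n)"
        unfolding divide_inverse power2_eq_square distrib_left by (simp only: mult_ac)
      define i W E where "i = inverse (v n)" and "W = ?w n" and "E = exp (- c t n)"
      have "N n = real n * ?H n * i\<^sup>2" "(t / v n)\<^sup>2 = t\<^sup>2 * i\<^sup>2"
        by (simp_all add: N_def i_def divide_inverse power_mult_distrib power_inverse)
      then have "N n * (t\<^sup>2 * q n / 2 * E - ?H n * W\<^sup>2)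
          = real n * (?H n * ((t / v n)\<^sup>2 * q n / 2 * E) - (?H n * (i * W))\<^sup>2)"
        by (simp add: right_diff_distrib power_mult_distrib power2_eq_square[of "?H n"])
      moreover have "N n * (t\<^sup>2 * (f x * \<kappa>) / 2 - \<eta>) \<le> N n * (t\<^sup>2 * q n / 2 * E - ?H n * W\<^sup>2)"
        using elim unfolding W_def E_def by (intro mult_left_mono less_imp_le) auto
      ultimately have "exp (N n * (t\<^sup>2 * (f x * \<kappa>) / 2 - \<eta>))
          \<le> exp (real n * (?H n * ((t / v n)\<^sup>2 * q n / 2 * exp (- c t n)) - (?H n * (inverse (v n) * ?w n))\<^sup>2))"
        unfolding i_def W_def E_def by (simp only: exp_le_cancel_iff)
      also have "\<dots> \<le> expectation (\<lambda>\<omega>. exp (real n * hs n ^ CARD('d) * (t / v n) * deviation (hs n) n x \<omega>))"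
        unfolding u[symmetric] unfolding q_def m_def
      proof (rule mgf_deviation_ge[OF n(1,2)])
        show "t / v n > 0" using n that by simp
        show "t / v n * b \<le> c t n" using n that by (simp add: c_def divide_inverse)
        show "?H n * (t / v n * mollify K (hs n) x
            + (t / v n)\<^sup>2 * mollify (\<lambda>z. (K z)\<^sup>2) (hs n) x / 2 * exp (- c t n)) \<le> 1"
          using elim u unfolding q_def m_def by linarith
      qed
      finally show ?case unfolding scale[OF n(3)] .
    qed
  qed
qed (use assms in auto)

end

section \<open>The probability of missing the density\<close>

lemma truncate_below_eq_max: "truncate_below e t = max e t"
  by (auto simp: truncate_below_def)

context confidence_band
begin

section \<open>The miss event and its reduction to a grid\<close>

definition width :: "real \<Rightarrow> nat \<Rightarrow> 'w \<Rightarrow> real^'d \<Rightarrow> real" where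
  "width \<delta> n \<omega> x = \<delta> * (sqrt (truncate_below (\<epsilon> n) (kde K (h n) X n \<omega> x) * \<kappa>) / v n)"

text \<open>The strict inequality matches the complement of a closed band and is an open condition
  in \<open>x\<close>, as \<open>sets_ex_continuous_pos\<close> requires.\<close>

definition miss :: "(real^'d) set \<Rightarrow> real \<Rightarrow> nat \<Rightarrow> 'w set" where
  "miss C \<delta> n = {\<omega> \<in> space M. \<exists>x\<in>C. width \<delta> n \<omega> x < \<bar>f x - kde K (hs n) X n \<omega> x\<bar>}"

lemma miss_measurable [measurable]: "miss C \<delta> n \<in> sets M"
proof -
  have "miss C \<delta> n = {\<omega> \<in> space M. \<exists>x\<in>C. \<bar>f x - kde K (hs n) X n \<omega> x\<bar> - width \<delta> n \<omega> x > 0}"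
    by (auto simp: miss_def)
  also have "\<dots> \<in> sets M"
    unfolding width_def truncate_below_eq_max divide_inverse
    by (intro sets_ex_continuous_pos continuous_intros kde_continuous
        continuous_on_subset[OF f_cont]) (auto intro: borel_measurable_max)
  finally show ?thesis .
qed

text \<open>Divided by a bandwidth of at least \<open>hs n ^ (CARD('d) + 4)\<close>, the mesh is at
  most \<open>hs n powr ((CARD('d) + 8) / \<alpha>)\<close>. The Hoelder exponent turns this into
  \<open>hs n ^ (CARD('d) + 8)\<close>, and the prefactor \<open>1 / k ^ CARD('d)\<close> of
  \<open>kde_holder\<close> leaves \<open>hs n ^ 4\<close>.\<close>

definition mesh :: "nat \<Rightarrow> real" where
  "mesh n = hs n powr (real CARD('d) + 4 + (real CARD('d) + 8) / \<alpha>)"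

text \<open>One power of \<open>hs n\<close> bounds both \<open>k\<close> and
  \<open>k ^ CARD('d)\<close> from below, so the same grid serves both bandwidths.\<close>

lemma kde_grid_le:
  assumes hs: "0 < hs n" and k: "k > 0"
    and le: "hs n ^ (CARD('d) + 4) \<le> k" "hs n ^ (CARD('d) + 4) \<le> k ^ CARD('d)"
    and dist: "dist x y \<le> real CARD('d) * mesh n"
  shows "\<bar>kde K k X n \<omega> x - kde K k X n \<omega> y\<bar> \<le> L * real CARD('d) powr \<alpha> * hs n ^ 4"
proof -
  let ?d = "real CARD('d)" and ?w = "hs n ^ (CARD('d) + 4)"
  have w: "?w = hs n powr (?d + 4)"
    using powr_realpow[OF hs, of "CARD('d) + 4"] by (simp add: add.commute)
  have mesh: "mesh n / ?w = hs n powr ((?d + 8) / \<alpha>)"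
    unfolding w mesh_def by (simp flip: powr_diff)
  have "\<bar>kde K k X n \<omega> x - kde K k X n \<omega> y\<bar> \<le> L / k ^ CARD('d) * (dist x y / k) powr \<alpha>"
    by (rule kde_holder[OF K_holder k])
  also have "\<dots> \<le> L / ?w * (?d * (mesh n / ?w)) powr \<alpha>"
    using le hs k dist L_nonneg \<alpha>
    by (intro mult_mono divide_left_mono powr_mono2)
      (auto intro!: frac_le mult_pos_pos zero_less_power simp: mesh_def simp del: power_Suc)
  also have "(?d * (mesh n / ?w)) powr \<alpha> = ?d powr \<alpha> * hs n powr (?d + 8)"
    unfolding mesh using \<alpha> by (simp add: powr_mult powr_powr)
  also have "hs n powr (?d + 8) = ?w * hs n ^ 4"
    using powr_realpow[OF hs, of "CARD('d) + 8"] by (simp add: add.commute flip: power_add)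
  finally show ?thesis using hs by simp
qed

lemma eventually_mesh_fine:
  assumes "\<eta> > 0"
  shows "\<forall>\<^sub>F n in sequentially. \<forall>x y \<omega>. dist x y \<le> real CARD('d) * mesh n \<longrightarrow>
    \<bar>f x - f y\<bar> \<le> \<eta> * (sqrt (\<kappa> * \<epsilon> n) / v n)
    \<and> \<bar>kde K (hs n) X n \<omega> x - kde K (hs n) X n \<omega> y\<bar> \<le> \<eta> * (sqrt (\<kappa> * \<epsilon> n) / v n)
    \<and> \<bar>kde K (h n) X n \<omega> x - kde K (h n) X n \<omega> y\<bar> \<le> \<eta> * \<epsilon> n"
proof -
  let ?d = "real CARD('d)"
  define D where "D = L * ?d powr \<alpha> + G * ?d"
  have "D * 0 < \<eta> * min 1 (sqrt \<kappa>)" using assms \<kappa>_pos by simp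
  then have "\<forall>\<^sub>F n in sequentially. D * hs n < \<eta> * min 1 (sqrt \<kappa>)"
    by (intro order_tendstoD(2)[OF tendsto_mult[OF tendsto_const hs_lim]])
  with eventually_pos eventually_polynomial show ?thesis
  proof eventually_elim
    case (elim n)
    then have "hs n ^ 3 \<le> hs n ^ 1" by (intro power_decreasing) auto
    then have hs3: "hs n ^ 3 \<le> \<epsilon> n" using elim by simp
    \<comment> \<open>Three powers of \<open>hs n\<close> stay below \<open>\<epsilon> n\<close> and
      \<open>sqrt (\<epsilon> n) / v n\<close>; the fourth makes the constant \<open>D\<close>
      harmless.\<close>
    have D: "D * hs n ^ 4 = D * hs n * hs n ^ 3" by (simp add: eval_nat_numeral)
    have "D * hs n < \<eta> * 1" "D * hs n < \<eta> * sqrt \<kappa>"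
      using elim assms min.cobounded1[of 1 "sqrt \<kappa>"] min.cobounded2[of 1 "sqrt \<kappa>"]
        mult_left_mono[of "min 1 (sqrt \<kappa>)" _ \<eta>] by (meson less_imp_le less_le_trans)+
    then have "D * hs n * hs n ^ 3 \<le> \<eta> * 1 * \<epsilon> n"
      "D * hs n * hs n ^ 3 \<le> (\<eta> * sqrt \<kappa>) * (sqrt (\<epsilon> n) / v n)"
      using hs3 elim assms \<kappa>_pos by - (rule mult_mono; auto)+
    then have D4: "D * hs n ^ 4 \<le> \<eta> * \<epsilon> n" "D * hs n ^ 4 \<le> \<eta> * (sqrt (\<kappa> * \<epsilon> n) / v n)"
      unfolding D by (simp_all add: real_sqrt_mult)
    have LD: "L * ?d powr \<alpha> * hs n ^ 4 \<le> D * hs n ^ 4" "G * ?d * hs n ^ 4 \<le> D * hs n ^ 4"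
      using elim G_nonneg L_nonneg by (auto simp: D_def intro!: mult_right_mono)
    have hs_le: "hs n ^ (CARD('d) + 4) \<le> hs n" "hs n ^ (CARD('d) + 4) \<le> hs n ^ CARD('d)"
      using power_decreasing[of 1 "CARD('d) + 4" "hs n"] power_decreasing[of "CARD('d)" "CARD('d) + 4" "hs n"] elim
      by simp_all
    have "mesh n \<le> hs n powr 4"
      unfolding mesh_def using elim \<alpha> by (intro powr_mono') auto
    also have "\<dots> = hs n ^ 4" using elim powr_realpow[of "hs n" 4] by simp
    finally have mesh: "mesh n \<le> hs n ^ 4" .
    show ?case
    proof (intro allI impI conjI)
      fix x y :: "real^'d" and \<omega> assume dist: "dist x y \<le> ?d * mesh n"
      have "\<bar>f x - f y\<bar> \<le> G * dist x y" by (rule f_lipschitz)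
      also have "\<dots> \<le> G * (?d * hs n ^ 4)"
        using dist mesh G_nonneg by (intro mult_left_mono) (auto intro: order_trans mult_left_mono)
      finally show "\<bar>f x - f y\<bar> \<le> \<eta> * (sqrt (\<kappa> * \<epsilon> n) / v n)"
        using LD(2) D4(2) by linarith
      show "\<bar>kde K (hs n) X n \<omega> x - kde K (hs n) X n \<omega> y\<bar> \<le> \<eta> * (sqrt (\<kappa> * \<epsilon> n) / v n)"
        using elim by (intro order_trans[OF kde_grid_le[OF _ _ hs_le dist] order_trans[OF LD(1) D4(2)]]) auto
      show "\<bar>kde K (h n) X n \<omega> x - kde K (h n) X n \<omega> y\<bar> \<le> \<eta> * \<epsilon> n"
        using elim by (intro order_trans[OF kde_grid_le[OF _ _ _ _ dist] order_trans[OF LD(1) D4(1)]]) auto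
    qed
  qed
qed

text \<open>Each \<open>3 * \<eta>\<close> counts three errors. For the truncated estimator they are
  grid, deviation and bias, each at most \<open>\<eta> * \<epsilon> n\<close>. For the centre they
  are the grid errors of \<open>f\<close> and of the estimator and the bias, in addition to the
  deviation \<open>\<gamma>\<close>.\<close>

lemma miss_subset:
  assumes \<eta>: "0 < \<eta>" "3 * \<eta> < 1" and \<gamma>: "\<gamma> + 3 * \<eta> \<le> \<delta> * sqrt (1 - 3 * \<eta>)" and \<delta>: "\<delta> > 0"
    and pos: "v n > 0" "\<epsilon> n > 0"
    and bias_hs: "c\<^sub>1 * (hs n)\<^sup>2 \<le> \<eta> * (sqrt (\<kappa> * \<epsilon> n) / v n)"
    and bias_h: "c\<^sub>1 * (h n)\<^sup>2 \<le> \<eta> * \<epsilon> n"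
    and grid: "\<And>x. x \<in> C \<Longrightarrow> \<exists>y\<in>S. \<forall>\<omega>. \<bar>f x - f y\<bar> \<le> \<eta> * (sqrt (\<kappa> * \<epsilon> n) / v n)
      \<and> \<bar>kde K (hs n) X n \<omega> x - kde K (hs n) X n \<omega> y\<bar> \<le> \<eta> * (sqrt (\<kappa> * \<epsilon> n) / v n)
      \<and> \<bar>kde K (h n) X n \<omega> x - kde K (h n) X n \<omega> y\<bar> \<le> \<eta> * \<epsilon> n"
  shows "miss C \<delta> n \<subseteq> (\<Union>y\<in>S.
    {\<omega> \<in> space M. \<gamma> * sqrt (\<kappa> * max (f y) (\<epsilon> n)) / v n \<le> \<bar>deviation (hs n) n y \<omega>\<bar>}
    \<union> {\<omega> \<in> space M. \<eta> * \<epsilon> n \<le> \<bar>deviation (h n) n y \<omega>\<bar>})"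
proof
  fix \<omega> assume "\<omega> \<in> miss C \<delta> n"
  then obtain x where \<omega>: "\<omega> \<in> space M" and x: "x \<in> C" "width \<delta> n \<omega> x < \<bar>f x - kde K (hs n) X n \<omega> x\<bar>"
    by (auto simp: miss_def)
  obtain y where y: "y \<in> S" and close: "\<bar>f x - f y\<bar> \<le> \<eta> * (sqrt (\<kappa> * \<epsilon> n) / v n)"
      "\<bar>kde K (hs n) X n \<omega> x - kde K (hs n) X n \<omega> y\<bar> \<le> \<eta> * (sqrt (\<kappa> * \<epsilon> n) / v n)"
      "\<bar>kde K (h n) X n \<omega> x - kde K (h n) X n \<omega> y\<bar> \<le> \<eta> * \<epsilon> n"
    using grid[OF x(1)] by blast
  define m where "m = max (f y) (\<epsilon> n)"
  define t where "t = truncate_below (\<epsilon> n) (kde K (h n) X n \<omega> x)"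
  have m: "m > 0" "\<epsilon> n \<le> m" using pos by (auto simp: m_def)
  have "\<gamma> * sqrt (\<kappa> * m) / v n \<le> \<bar>deviation (hs n) n y \<omega>\<bar> \<or> \<eta> * \<epsilon> n \<le> \<bar>deviation (h n) n y \<omega>\<bar>"
  proof (rule ccontr)
    assume "\<not> ?thesis"
    then have dev: "\<bar>deviation (hs n) n y \<omega>\<bar> < \<gamma> * (sqrt (\<kappa> * m) / v n)" "\<bar>deviation (h n) n y \<omega>\<bar> < \<eta> * \<epsilon> n"
      by auto
    have "kde K (h n) X n \<omega> x \<ge> f y - 3 * (\<eta> * \<epsilon> n)"
      using dev(2) close(3) bias[of "h n" y] bias_h unfolding deviation_def by linarith
    moreover have "3 * \<eta> * \<epsilon> n \<le> 3 * \<eta> * m" using m \<eta> by simp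
    moreover have "kde K (h n) X n \<omega> x \<le> t" "\<epsilon> n \<le> t"
      by (auto simp: t_def truncate_below_eq_max)
    moreover have "0 \<le> 3 * \<eta> * m" using m \<eta> by simp
    \<comment> \<open>If \<open>f y \<ge> \<epsilon> n\<close>, the lower bound on the estimator
      passes to \<open>t\<close>; otherwise \<open>m = \<epsilon> n\<close>, and the truncation
      gives \<open>t \<ge> m\<close>.\<close>
    ultimately have "m - 3 * \<eta> * m \<le> t"
      by (cases "f y \<ge> \<epsilon> n") (auto simp: m_def max_def)
    then have "(1 - 3 * \<eta>) * m \<le> t" by (simp add: left_diff_distrib)
    then have "(1 - 3 * \<eta>) * m * \<kappa> \<le> t * \<kappa>" using \<kappa>_pos by simp
    then have "sqrt (1 - 3 * \<eta>) * sqrt (\<kappa> * m) \<le> sqrt (t * \<kappa>)"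
      unfolding real_sqrt_mult[symmetric] by (simp add: mult_ac)
    then have "\<delta> * (sqrt (1 - 3 * \<eta>) * sqrt (\<kappa> * m) / v n) \<le> width \<delta> n \<omega> x"
      unfolding width_def t_def using \<delta> pos by (intro mult_left_mono divide_right_mono) auto
    moreover have "(\<gamma> + 3 * \<eta>) * (sqrt (\<kappa> * m) / v n) \<le> \<delta> * sqrt (1 - 3 * \<eta>) * (sqrt (\<kappa> * m) / v n)"
      using \<gamma> m \<kappa>_pos pos by (intro mult_right_mono) auto
    moreover have "\<eta> * (sqrt (\<kappa> * \<epsilon> n) / v n) \<le> \<eta> * (sqrt (\<kappa> * m) / v n)"
      using \<eta> m \<kappa>_pos pos by (intro mult_left_mono divide_right_mono) auto
    then have "\<bar>f x - kde K (hs n) X n \<omega> x\<bar> \<le> \<gamma> * (sqrt (\<kappa> * m) / v n) + 3 * (\<eta> * (sqrt (\<kappa> * m) / v n))"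
      using dev(1) close(1,2) bias[of "hs n" y] bias_hs unfolding deviation_def by linarith
    ultimately show False using x(2) by (simp add: algebra_simps add_divide_distrib)
  qed
  then show "\<omega> \<in> (\<Union>y\<in>S.
    {\<omega> \<in> space M. \<gamma> * sqrt (\<kappa> * max (f y) (\<epsilon> n)) / v n \<le> \<bar>deviation (hs n) n y \<omega>\<bar>}
    \<union> {\<omega> \<in> space M. \<eta> * \<epsilon> n \<le> \<bar>deviation (h n) n y \<omega>\<bar>})"
    using \<omega> y by (auto simp: m_def)
qed

lemma prob_miss_le:
  assumes "bounded C" and \<delta>: "\<delta> > 0" and "\<eta>' > 0"
  shows "\<forall>\<^sub>F n in sequentially. prob (miss C \<delta> n) \<le> exp (- (N n * (\<delta>\<^sup>2 / 2 - \<eta>')))"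
proof -
  define g where "g = (\<lambda>\<eta>. \<delta> * sqrt (1 - 3 * \<eta>) - 3 * \<eta>)"
  have g: "(g \<longlongrightarrow> \<delta> * sqrt (1 - 3 * 0) - 3 * 0) (at_right 0)"
    unfolding g_def by (intro tendsto_intros)
  have "((\<lambda>\<eta>. (g \<eta>)\<^sup>2 / 2 - 3 * \<eta>) \<longlongrightarrow> (\<delta> * sqrt (1 - 3 * 0) - 3 * 0)\<^sup>2 / 2 - 3 * 0) (at_right 0)"
    by (intro tendsto_intros g) auto
  then have "\<forall>\<^sub>F \<eta> in at_right 0. \<delta>\<^sup>2 / 2 - \<eta>' < (g \<eta>)\<^sup>2 / 2 - 3 * \<eta>"
    using \<open>\<eta>' > 0\<close> by (intro order_tendstoD(1)) auto
  moreover have "\<forall>\<^sub>F \<eta> in at_right 0. 0 < g \<eta>"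
    using \<delta> by (intro order_tendstoD(1)[OF g]) auto
  moreover have "\<forall>\<^sub>F \<eta> in at_right 0. \<eta> < (1/3 :: real)"
    by (intro order_tendstoD(2)[OF tendsto_ident_at]) auto
  ultimately have "\<forall>\<^sub>F \<eta> in at_right (0::real).
      \<delta>\<^sup>2 / 2 - \<eta>' < (g \<eta>)\<^sup>2 / 2 - 3 * \<eta> \<and> 0 < g \<eta> \<and> \<eta> < 1/3 \<and> 0 < \<eta>"
    using eventually_at_right_less by eventually_elim auto
  then obtain \<eta> where \<eta>: "\<delta>\<^sup>2 / 2 - \<eta>' < (g \<eta>)\<^sup>2 / 2 - 3 * \<eta>" "g \<eta> > 0" "\<eta> < 1/3" "0 < \<eta>"
    using eventually_happens[of _ "at_right (0::real)"] trivial_limit_at_right_real by blast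
  let ?d = "real CARD('d)"
  define p where "p = ?d + 4 + (?d + 8) / \<alpha>"
  obtain A where A: "A \<ge> 1" "\<And>\<rho>. \<rho> \<in> {0<..1} \<Longrightarrow> \<exists>S. finite S \<and> real (card S) \<le> (A / \<rho>) ^ CARD('d)
      \<and> (\<forall>x\<in>C. \<exists>y\<in>S. dist x y \<le> ?d * \<rho>)"
    using grid_cover[OF \<open>bounded C\<close>] by blast
  \<comment> \<open>The logarithm of the cardinality bound \<open>(A / mesh n) ^ CARD('d)\<close>,
    divided by \<open>N n\<close>.\<close>
  have "(\<lambda>n. ?d * ln A * inverse (N n) + ?d * p * (ln (1 / hs n) / N n)) \<longlonglongrightarrow> ?d * ln A * 0 + ?d * p * 0"
    by (intro tendsto_intros tendsto_inverse_0_at_top[OF N_lim] ln_inverse_hs_over_N)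
  then have ev1: "\<forall>\<^sub>F n in sequentially. ?d * ln A * inverse (N n) + ?d * p * (ln (1 / hs n) / N n) < \<eta>"
    using \<eta> by (intro order_tendstoD(2)) auto
  have "(\<lambda>n. c\<^sub>1 / sqrt \<kappa> * (v n * (hs n)\<^sup>2 / sqrt (\<epsilon> n))) \<longlonglongrightarrow> 0"
    by (rule tendsto_mult_right_zero[OF v_hs2])
  from eventually_less[OF this \<eta>(4)]
  have ev2: "\<forall>\<^sub>F n in sequentially. c\<^sub>1 / sqrt \<kappa> * (v n * (hs n)\<^sup>2 / sqrt (\<epsilon> n)) < \<eta>" .
  have "(\<lambda>n. c\<^sub>1 * ((h n)\<^sup>2 / \<epsilon> n)) \<longlonglongrightarrow> 0"
    by (rule tendsto_mult_right_zero[OF h2_\<epsilon>])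
  from eventually_less[OF this \<eta>(4)]
  have ev3: "\<forall>\<^sub>F n in sequentially. c\<^sub>1 * ((h n)\<^sup>2 / \<epsilon> n) < \<eta>" .
  \<comment> \<open>With this exponent the deviations at bandwidth \<open>h n\<close> are no more
    likely than the bound for those at \<open>hs n\<close>.\<close>
  have R: "(g \<eta>)\<^sup>2 / 2 > 0" using \<eta> by simp
  show ?thesis
    using eventually_pos eventually_polynomial eventually_mesh_fine[OF \<eta>(4)] ev1 ev2 ev3
      prob_deviation_hs_le[OF \<eta>(2,4)] prob_deviation_h_le[OF \<eta>(4) R] eventually_N_gt[of "ln 4 / \<eta>"]
  proof eventually_elim
    case (elim n)
    have mesh: "mesh n \<in> {0<..1}"
      using elim \<alpha> powr_mono'[of 0 p "hs n"] by (auto simp: mesh_def p_def)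
    obtain S where S: "finite S" "real (card S) \<le> (A / mesh n) ^ CARD('d)"
        "\<And>x. x \<in> C \<Longrightarrow> \<exists>y\<in>S. dist x y \<le> ?d * mesh n"
      using A(2)[OF mesh] by blast
    define U where "U = (\<lambda>y. {\<omega> \<in> space M. g \<eta> * sqrt (\<kappa> * max (f y) (\<epsilon> n)) / v n \<le> \<bar>deviation (hs n) n y \<omega>\<bar>})"
    define V where "V = (\<lambda>y. {\<omega> \<in> space M. \<eta> * \<epsilon> n \<le> \<bar>deviation (h n) n y \<omega>\<bar>})"
    have [measurable]: "U y \<in> sets M" "V y \<in> sets M" for y
      unfolding U_def V_def by measurable
    let ?e = "exp (- (N n * ((g \<eta>)\<^sup>2 / 2 - \<eta>)))"
    have UV: "prob (U y \<union> V y) \<le> 4 * ?e" for y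
    proof -
      have "prob (U y \<union> V y) \<le> prob (U y) + prob (V y)" by (rule measure_Un_le) auto
      also have "\<dots> \<le> 2 * ?e + 2 * exp (- (N n * ((g \<eta>)\<^sup>2 / 2)))"
        using elim(7,8) unfolding U_def V_def by (intro add_mono) auto
      also have "exp (- (N n * ((g \<eta>)\<^sup>2 / 2))) \<le> ?e"
        using \<eta> elim by (auto intro!: mult_left_mono)
      finally show ?thesis by simp
    qed
    have "miss C \<delta> n \<subseteq> (\<Union>y\<in>S. U y \<union> V y)"
      unfolding U_def V_def
    proof (rule miss_subset)
      show "c\<^sub>1 * (hs n)\<^sup>2 \<le> \<eta> * (sqrt (\<kappa> * \<epsilon> n) / v n)"
        using elim \<kappa>_pos by (simp add: real_sqrt_mult field_simps)
      show "c\<^sub>1 * (h n)\<^sup>2 \<le> \<eta> * \<epsilon> n"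
        using elim by (simp add: field_simps)
      show "\<exists>y\<in>S. \<forall>\<omega>. \<bar>f x - f y\<bar> \<le> \<eta> * (sqrt (\<kappa> * \<epsilon> n) / v n)
        \<and> \<bar>kde K (hs n) X n \<omega> x - kde K (hs n) X n \<omega> y\<bar> \<le> \<eta> * (sqrt (\<kappa> * \<epsilon> n) / v n)
        \<and> \<bar>kde K (h n) X n \<omega> x - kde K (h n) X n \<omega> y\<bar> \<le> \<eta> * \<epsilon> n" if "x \<in> C" for x
        using S(3)[OF that] elim(3) by blast
    qed (use elim \<eta> \<delta> in \<open>auto simp: g_def\<close>)
    then have "prob (miss C \<delta> n) \<le> prob (\<Union>y\<in>S. U y \<union> V y)"
      using S(1) by (intro finite_measure_mono) auto
    also have "\<dots> \<le> (\<Sum>y\<in>S. prob (U y \<union> V y))"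
      using S(1) by (intro measure_UNION_le) auto
    also have "\<dots> \<le> (\<Sum>y\<in>S. 4 * ?e)" by (intro sum_mono UV)
    also have "\<dots> = real (card S) * (4 * ?e)" by simp
    also have "\<dots> \<le> exp (\<eta> * N n) * (exp (\<eta> * N n) * ?e)"
    proof (intro mult_mono)
      have "A / mesh n > 0" using A(1) mesh by simp
      have "ln (A / mesh n) = ln A + p * ln (1 / hs n)"
        using A(1) elim mesh by (simp add: ln_div mesh_def p_def ln_powr)
      then have "?d * ln (A / mesh n) = (?d * ln A * inverse (N n) + ?d * p * (ln (1 / hs n) / N n)) * N n"
        using elim by (simp add: field_simps)
      also have "\<dots> \<le> \<eta> * N n" using elim by (intro mult_right_mono) auto
      finally have "exp (ln (A / mesh n) * ?d) \<le> exp (\<eta> * N n)" by (simp add: mult.commute)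
      also have "exp (ln (A / mesh n) * ?d) = (A / mesh n) ^ CARD('d)"
        using \<open>A / mesh n > 0\<close> by (simp add: mult.commute exp_of_nat_mult)
      finally show "real (card S) \<le> exp (\<eta> * N n)" using S(2) by simp
      have "ln 4 \<le> \<eta> * N n" using elim \<eta> by (simp add: divide_less_eq mult.commute)
      then show "4 \<le> exp (\<eta> * N n)" by (simp add: ln_ge_iff[symmetric] flip: ln_le_cancel_iff)
    qed auto
    also have "\<dots> = exp (- (N n * ((g \<eta>)\<^sup>2 / 2 - 3 * \<eta>)))"
      unfolding exp_add[symmetric] by (rule arg_cong[of _ _ exp]) (simp add: algebra_simps)
    also have "\<dots> \<le> exp (- (N n * (\<delta>\<^sup>2 / 2 - \<eta>')))"
      using \<eta>(1) elim by (auto intro!: mult_left_mono)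
    finally show ?case .
  qed
qed

text \<open>A large upward deviation at bandwidth \<open>hs\<close> forces a miss at
  \<open>x\<close> unless the estimator that sets the width is off by \<open>\<epsilon> n\<close>.
  The latter event is exponentially rarer, so subtracting it costs at most a factor 2.\<close>

lemma prob_miss_ge:
  assumes x: "x \<in> C" "f x > 0" and \<delta>: "\<delta> > 0" and \<eta>: "\<eta> > 0"
  shows "\<forall>\<^sub>F n in sequentially. exp (- (N n * (\<delta>\<^sup>2 / 2 + \<eta>))) \<le> prob (miss C \<delta> n)"
proof -
  \<comment> \<open>\<open>f x + \<zeta>\<close> will bound the truncated estimator, and the
    separate \<open>\<zeta>\<close> pays for \<open>v n\<close> times the bias at bandwidth
    \<open>hs n\<close>.\<close>
  define \<tau> where "\<tau> = (\<lambda>\<zeta>. \<delta> * sqrt ((f x + \<zeta>) * \<kappa>) + \<zeta>)"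
  have "((\<lambda>\<zeta>. (\<tau> \<zeta>)\<^sup>2 / (2 * (f x * \<kappa>))) \<longlongrightarrow> (\<delta> * sqrt ((f x + 0) * \<kappa>) + 0)\<^sup>2 / (2 * (f x * \<kappa>))) (at_right 0)"
    unfolding \<tau>_def using x \<kappa>_pos by (intro tendsto_intros) auto
  then have "\<forall>\<^sub>F \<zeta> in at_right 0. (\<tau> \<zeta>)\<^sup>2 / (2 * (f x * \<kappa>)) < \<delta>\<^sup>2 / 2 + \<eta> / 3"
    using x \<kappa>_pos \<eta> by (intro order_tendstoD(2)) (auto simp: power_mult_distrib)
  then have "\<forall>\<^sub>F \<zeta> in at_right (0::real). (\<tau> \<zeta>)\<^sup>2 / (2 * (f x * \<kappa>)) < \<delta>\<^sup>2 / 2 + \<eta> / 3 \<and> 0 < \<zeta>"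
    using eventually_at_right_less by eventually_elim auto
  then obtain \<zeta> where \<zeta>: "(\<tau> \<zeta>)\<^sup>2 / (2 * (f x * \<kappa>)) < \<delta>\<^sup>2 / 2 + \<eta> / 3" "\<zeta> > 0"
    using eventually_happens[of _ "at_right (0::real)"] trivial_limit_at_right_real by blast
  define a where "a = (\<tau> \<zeta>)\<^sup>2 / (2 * (f x * \<kappa>)) + \<eta> / 3"
  have "a > 0" "\<tau> \<zeta> \<ge> 0" using x \<kappa>_pos \<eta> \<zeta> \<delta> by (auto simp: a_def \<tau>_def intro!: add_nonneg_pos)
  have "(\<lambda>n. c\<^sub>1 * (h n)\<^sup>2 + \<epsilon> n) \<longlonglongrightarrow> c\<^sub>1 * 0\<^sup>2 + 0" by (intro tendsto_intros h_lim \<epsilon>_lim)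
  then have ev1: "\<forall>\<^sub>F n in sequentially. c\<^sub>1 * (h n)\<^sup>2 + \<epsilon> n < \<zeta>"
    using \<zeta> by (intro order_tendstoD(2)) auto
  \<comment> \<open>Multiplying \<open>v_hs2\<close> by the vanishing
    \<open>sqrt (\<epsilon> n)\<close> shows that the bias scaled by \<open>v n\<close>
    vanishes.\<close>
  have "(\<lambda>n. c\<^sub>1 * (v n * (hs n)\<^sup>2 / sqrt (\<epsilon> n) * sqrt (\<epsilon> n))) \<longlonglongrightarrow> c\<^sub>1 * (0 * sqrt 0)"
    by (intro tendsto_intros v_hs2 \<epsilon>_lim)
  then have ev2: "\<forall>\<^sub>F n in sequentially. c\<^sub>1 * (v n * (hs n)\<^sup>2 / sqrt (\<epsilon> n) * sqrt (\<epsilon> n)) < \<zeta>"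
    using \<zeta> by (intro order_tendstoD(2)) auto
  have ev3: "\<forall>\<^sub>F n in sequentially. exp (- (N n * a)) \<le> prob {\<omega> \<in> space M. v n * deviation (hs n) n x \<omega> > \<tau> \<zeta>}"
    unfolding a_def using x \<open>\<tau> \<zeta> \<ge> 0\<close> \<eta> by (intro prob_deviation_hs_ge) auto
  show ?thesis
    using eventually_pos ev1 ev2 ev3 prob_deviation_h_le[OF zero_less_one add_pos_pos[OF \<open>a > 0\<close> zero_less_one]]
      \<comment> \<open>\<open>ln 4\<close> makes \<open>2 * exp (- N n)\<close> at most 1/2, so
        that the exceptional event takes at most half of the lower bound;
        \<open>3 * ln 2 / \<eta>\<close> absorbs the half that is left.\<close>
      eventually_less[OF \<epsilon>_lim \<zeta>(2)] eventually_N_gt[of "ln 4"] eventually_N_gt[of "3 * ln 2 / \<eta>"]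
  proof eventually_elim
    case (elim n)
    define U where "U = {\<omega> \<in> space M. v n * deviation (hs n) n x \<omega> > \<tau> \<zeta>}"
    define V where "V = {\<omega> \<in> space M. 1 * \<epsilon> n \<le> \<bar>deviation (h n) n x \<omega>\<bar>}"
    have [measurable]: "U \<in> sets M" "V \<in> sets M" unfolding U_def V_def by measurable
    have "U \<subseteq> miss C \<delta> n \<union> V"
    proof
      fix \<omega> assume U: "\<omega> \<in> U"
      have "\<omega> \<in> miss C \<delta> n" if "\<omega> \<notin> V"
      proof -
        have dev: "\<bar>deviation (h n) n x \<omega>\<bar> < \<epsilon> n" using that U by (auto simp: U_def V_def)
        \<comment> \<open>Either the floor is active and \<open>\<epsilon> n < \<zeta>\<close>, or
          the estimator exceeds \<open>f x\<close> by at most bias plus deviation, which is below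
          \<open>\<zeta>\<close>.\<close>
        have "truncate_below (\<epsilon> n) (kde K (h n) X n \<omega> x) \<le> f x + \<zeta>"
          unfolding truncate_below_eq_max using dev bias[of "h n" x] elim f_nonneg[of x]
          by (auto simp: deviation_def abs_le_iff abs_less_iff)
        then have "\<delta> * sqrt (truncate_below (\<epsilon> n) (kde K (h n) X n \<omega> x) * \<kappa>) \<le> \<delta> * sqrt ((f x + \<zeta>) * \<kappa>)"
          using \<delta> \<kappa>_pos by simp
        also have "\<dots> < v n * deviation (hs n) n x \<omega> - \<zeta>"
          using U by (auto simp: U_def \<tau>_def)
        also have "\<dots> \<le> v n * (deviation (hs n) n x \<omega> - c\<^sub>1 * (hs n)\<^sup>2)"
          using elim by (simp add: algebra_simps)
        also have "\<dots> \<le> v n * \<bar>f x - kde K (hs n) X n \<omega> x\<bar>"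
          using bias[of "hs n" x] elim by (intro mult_left_mono) (auto simp: deviation_def abs_if split: if_splits)
        finally have "width \<delta> n \<omega> x < \<bar>f x - kde K (hs n) X n \<omega> x\<bar>"
          using elim by (simp add: width_def divide_less_eq mult.commute)
        then show ?thesis using x U by (auto simp: miss_def U_def)
      qed
      then show "\<omega> \<in> miss C \<delta> n \<union> V" by blast
    qed
    then have "prob U \<le> prob (miss C \<delta> n \<union> V)" by (intro finite_measure_mono) auto
    also have "\<dots> \<le> prob (miss C \<delta> n) + prob V" by (intro measure_Un_le) auto
    also have "prob V \<le> exp (- (N n * a)) / 2"
    proof -
      have "prob V \<le> 2 * exp (- (N n * (a + 1)))" using elim unfolding V_def by blast
      also have "\<dots> = exp (- (N n * a)) * (2 * exp (- N n))"
        by (simp add: algebra_simps flip: exp_add)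
      also have "\<dots> \<le> exp (- (N n * a)) * (2 * exp (- ln 4))"
        using elim by (intro mult_left_mono) auto
      finally show ?thesis by (simp add: exp_minus)
    qed
    finally have "exp (- (N n * a)) * (1 / 2) \<le> prob (miss C \<delta> n)"
      using elim unfolding U_def by simp
    moreover have "exp (- (N n * (\<eta> / 3))) \<le> exp (- ln 2)"
      using elim \<eta> by (simp add: divide_less_eq mult.commute)
    then have "exp (- (N n * a)) * exp (- (N n * (\<eta> / 3))) \<le> exp (- (N n * a)) * (1 / 2)"
      by (intro mult_left_mono) (auto simp: exp_minus)
    moreover have "exp (- (N n * (\<delta>\<^sup>2 / 2 + \<eta>))) \<le> exp (- (N n * (a + \<eta> / 3)))"
      using \<zeta> elim by (auto simp: a_def intro!: mult_left_mono)
    moreover have "exp (- (N n * (a + \<eta> / 3))) = exp (- (N n * a)) * exp (- (N n * (\<eta> / 3)))"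
      by (simp add: algebra_simps flip: exp_add)
    ultimately show ?case by linarith
  qed
qed

lemma ln_prob_miss_lim:
  assumes "bounded C" "x \<in> C" "f x > 0" and \<delta>: "\<delta> > 0"
  shows "(\<lambda>n. (v n)\<^sup>2 / (real n * hs n ^ CARD('d)) * ln (prob (miss C \<delta> n))) \<longlonglongrightarrow> - (\<delta>\<^sup>2 / 2)"
proof (rule tendstoI)
  fix r :: real assume r: "r > 0"
  then have "r / 2 > 0" by simp
  show "\<forall>\<^sub>F n in sequentially.
      dist ((v n)\<^sup>2 / (real n * hs n ^ CARD('d)) * ln (prob (miss C \<delta> n))) (- (\<delta>\<^sup>2 / 2)) < r"
    using eventually_pos prob_miss_le[OF assms(1) \<delta> \<open>r / 2 > 0\<close>] prob_miss_ge[OF assms(2-4) \<open>r / 2 > 0\<close>]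
  proof eventually_elim
    case (elim n)
    \<comment> \<open>Positivity has to come from the lower bound: \<open>ln 0 = 0\<close>, so
      taking logarithms in the upper bound needs a nonzero probability.\<close>
    have pos: "prob (miss C \<delta> n) > 0" using elim(3) by (rule less_le_trans[OF exp_gt_zero])
    have "ln (prob (miss C \<delta> n)) \<le> N n * (- (\<delta>\<^sup>2 / 2) + r / 2)"
      using ln_mono[OF elim(2) pos] by (simp add: algebra_simps)
    moreover have "N n * (- (\<delta>\<^sup>2 / 2) - r / 2) \<le> ln (prob (miss C \<delta> n))"
      using ln_mono[OF elim(3) exp_gt_zero] by (simp add: algebra_simps)
    ultimately have "\<bar>ln (prob (miss C \<delta> n)) / N n - (- (\<delta>\<^sup>2 / 2))\<bar> \<le> r / 2"
      using elim by (simp add: abs_le_iff field_simps)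
    moreover have "(v n)\<^sup>2 / (real n * hs n ^ CARD('d)) * ln (prob (miss C \<delta> n)) = ln (prob (miss C \<delta> n)) / N n"
      by (simp add: N_def)
    ultimately show ?case using r by (simp add: dist_real_def)
  qed
qed

text \<open>Since \<open>ln (1 / hs) = o(N)\<close>, the probability is eventually at most any fixed power of \<open>hs\<close>.
  Where \<open>hs\<close> is too large for this to give \<open>1 / n\<^sup>2\<close>, the bound \<open>N \<ge> n * hs ^ (CARD('d) + 4)\<close> shows
  that \<open>N\<close> is at least \<open>sqrt n\<close>.\<close>

lemma summable_prob_miss:
  assumes "bounded C" and \<delta>: "\<delta> > 0"
  shows "summable (\<lambda>n. prob (miss C \<delta> n))"
proof -
  define c where "c = \<delta>\<^sup>2 / 4"
  have c: "c > 0" "\<delta>\<^sup>2 / 2 - c = c" using \<delta> by (auto simp: c_def)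
  let ?d = "real CARD('d)"
  \<comment> \<open>This constant gives \<open>exp (- (N n * c)) \<le> w ^ 4\<close> for
    \<open>w = hs n ^ (CARD('d) + 4)\<close>, and \<open>w \<le> 1 / sqrt n\<close> then gives the
    summable \<open>1 / n\<^sup>2\<close>.\<close>
  have "\<forall>\<^sub>F n in sequentially. ln (1 / hs n) / N n < c / (4 * (?d + 4))"
    by (intro order_tendstoD(2)[OF ln_inverse_hs_over_N]) (use c in auto)
  moreover have "\<forall>\<^sub>F n in sequentially. exp (- (c * sqrt (real n))) \<le> inverse (real n ^ 2)"
    using c(1) by real_asymp
  ultimately have "\<forall>\<^sub>F n in sequentially. norm (prob (miss C \<delta> n)) \<le> inverse (real n ^ 2)"
    using eventually_pos eventually_polynomial prob_miss_le[OF assms c(1)]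
  proof eventually_elim
    case (elim n)
    define w where "w = hs n ^ (CARD('d) + 4)"
    have w: "w > 0" "ln w = (?d + 4) * ln (hs n)"
      using elim by (auto simp: w_def ln_realpow)
    have le: "prob (miss C \<delta> n) \<le> exp (- (N n * c))" using elim c by simp
    show ?case
    proof (cases "w \<le> inverse (sqrt (real n))")
      case True
      have "ln (1 / hs n) * (4 * (?d + 4)) < N n * c"
        using elim by (simp add: field_simps)
      then have "- (N n * c) \<le> 4 * ln w" using elim w by (simp add: ln_div algebra_simps)
      then have "exp (- (N n * c)) \<le> exp (real 4 * ln w)" by simp
      also have "\<dots> = w ^ 4" unfolding exp_of_nat_mult using w(1) by simp
      also have "\<dots> \<le> inverse (sqrt (real n)) ^ 4" using True w by (intro power_mono) auto
      also have "\<dots> = inverse ((sqrt (real n) ^ 2) ^ 2)" using power_mult[of "sqrt (real n)" 2 2] by (simp add: power_inverse)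
      also have "\<dots> = inverse (real n ^ 2)" by simp
      finally show ?thesis using le by simp
    next
      case False
      have "sqrt (real n) = real n * inverse (sqrt (real n))"
        by (simp add: real_div_sqrt flip: divide_inverse)
      also have "\<dots> \<le> real n * w" using False by (intro mult_left_mono) auto
      also have "\<dots> \<le> N n"
      proof -
        \<comment> \<open>The four extra powers of \<open>hs n\<close> in \<open>w\<close> are at
          most \<open>1 / (v n)\<^sup>2\<close>.\<close>
        have "(v n * (hs n)\<^sup>2)\<^sup>2 \<le> 1\<^sup>2" using elim by (intro power_mono) auto
        then have "real n * hs n ^ CARD('d) * (v n * (hs n)\<^sup>2)\<^sup>2 \<le> real n * hs n ^ CARD('d) * 1"
          using elim by (intro mult_left_mono) auto
        then show ?thesis
          using elim by (simp add: N_def w_def power_add power_mult_distrib pos_le_divide_eq mult_ac flip: power_mult)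
      qed
      finally have "exp (- (N n * c)) \<le> exp (- (c * sqrt (real n)))"
        using c by (simp add: mult.commute)
      also have "\<dots> \<le> inverse (real n ^ 2)" using elim by simp
      finally show ?thesis using le by simp
    qed
  qed
  then show ?thesis
    by (rule summable_comparison_test_ev) (rule inverse_power_summable, simp)
qed

lemma AE_eventually_not_miss:
  assumes "bounded C" "\<delta> > 0"
  shows "AE \<omega> in M. \<forall>\<^sub>F n in sequentially. \<omega> \<in> space M - miss C \<delta> n"
  using summable_prob_miss[OF assms] by (intro borel_cantelli_AE1) (auto simp: emeasure_eq_measure)

end

theorem theorem3:
  fixes M :: "'w measure"
    and X :: "nat \<Rightarrow> 'w \<Rightarrow> real^'d"
    and f :: "real^'d \<Rightarrow> real"
    and grad_f :: "real^'d \<Rightarrow> real^'d"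
    and D2f :: "real^'d \<Rightarrow> (real^'d) \<Rightarrow>\<^sub>L (real^'d)"
    and K :: "real^'d \<Rightarrow> real"
    and h hs v \<epsilon> :: "nat \<Rightarrow> real"
    and C :: "(real^'d) set"
    and \<kappa> \<delta> :: real
    and T :: "nat \<Rightarrow> 'w \<Rightarrow> real^'d \<Rightarrow> real"
  assumes "prob_space M"
    and "prob_space.indep_vars M (\<lambda>_. borel) X {1..}"
    and "\<And>j. j \<ge> 1 \<Longrightarrow> distributed M lborel (X j) (\<lambda>x. ennreal (f x))"
    and "\<And>x. f x \<ge> 0"
    and "bounded (range f)"
    and "bounded (range K)"
    and "\<And>z. K z \<ge> 0"
    and "(K \<longlongrightarrow> 0) at_infinity"
    and "\<And>n. n \<ge> 1 \<Longrightarrow> h n > 0" and "h \<longlonglongrightarrow> 0"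
    and "\<And>n. n \<ge> 1 \<Longrightarrow> hs n > 0" and "hs \<longlonglongrightarrow> 0"
    and "\<And>n. n \<ge> 1 \<Longrightarrow> v n > 0" and "filterlim v at_top sequentially"
    and "\<kappa> = (\<integral>z. (K z)\<^sup>2 \<partial>lborel)"
    and "integrable lborel K" and "(\<integral>z. K z \<partial>lborel) = 1"
    and "\<And>j. (\<integral>z. z $ j * K z \<partial>lborel) = 0"
    and "integrable lborel (\<lambda>z. (norm z)\<^sup>2 * \<bar>K z\<bar>)"
    and "holder_continuous K"
    and "covering_number_condition K"
    and "\<And>x. GDERIV f x :> grad_f x"
    and "\<And>x. (grad_f has_derivative blinfun_apply (D2f x)) (at x)"
    and "bounded (range grad_f)"
    and "bounded (range D2f)"
    and "compact C" and "\<exists>x\<in>C. f x \<noteq> 0"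
    and "\<And>n. n \<ge> 1 \<Longrightarrow> \<epsilon> n > 0" and "\<epsilon> \<longlonglongrightarrow> 0"
    and "(\<lambda>n. hs n / \<epsilon> n) \<longlonglongrightarrow> 0"
    and "(\<lambda>n. (h n)\<^sup>2 / \<epsilon> n) \<longlonglongrightarrow> 0"
    and "filterlim (\<lambda>n. v n * \<epsilon> n powr (3/2)) at_top sequentially"
    and "(\<lambda>n. v n * (hs n)\<^sup>2 / sqrt (\<epsilon> n)) \<longlonglongrightarrow> 0"
    and "filterlim (\<lambda>n. real n * hs n ^ CARD('d) / ((v n)\<^sup>2 * ln (1 / hs n))) at_top sequentially"
    and "filterlim (\<lambda>n. (v n)\<^sup>2 * h n ^ CARD('d) * (\<epsilon> n)\<^sup>2 / hs n ^ CARD('d)) at_top sequentially"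
    and "\<And>n \<omega> x. T n \<omega> x = truncate_below (\<epsilon> n) (kde K (h n) X n \<omega> x)"
    and "\<delta> > 0"
  shows "((\<lambda>n. (v n)\<^sup>2 / (real n * hs n ^ CARD('d)) *
            ln (measure M {\<omega>\<in>space M. \<exists>x\<in>C. f x \<notin>
                  {kde K (hs n) X n \<omega> x - \<delta> * (sqrt (T n \<omega> x * \<kappa>) / v n) ..
                   kde K (hs n) X n \<omega> x + \<delta> * (sqrt (T n \<omega> x * \<kappa>) / v n)}}))
          \<longlonglongrightarrow> - (\<delta>\<^sup>2 / 2))
       \<and> asymptotic_as_confidence_regions M
           (\<lambda>n \<omega>. {g. \<forall>x\<in>C. \<bar>g x - kde K (hs n) X n \<omega> x\<bar> \<le> \<delta> * (sqrt (T n \<omega> x * \<kappa>) / v n)}) f"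
proof -
  interpret prob_space M by fact
  obtain b where b: "\<And>z. \<bar>K z\<bar> \<le> b" using \<open>bounded (range K)\<close> by (auto simp: bounded_iff)
  obtain B where B: "\<And>x. \<bar>f x\<bar> \<le> B" using \<open>bounded (range f)\<close> by (auto simp: bounded_iff)
  obtain G where G: "\<And>x. norm (grad_f x) \<le> G" using \<open>bounded (range grad_f)\<close> by (auto simp: bounded_iff)
  obtain H where H: "\<And>x. norm (D2f x) \<le> H" using \<open>bounded (range D2f)\<close> by (auto simp: bounded_iff)
  obtain L \<alpha> where \<alpha>: "0 < \<alpha>" "\<alpha> \<le> 1" and L: "\<And>x y. dist (K x) (K y) \<le> L * dist x y powr \<alpha>"
    using \<open>holder_continuous K\<close> unfolding holder_continuous_def by blast
  have "L * dist 0 (axis undefined 1 :: real^'d) powr \<alpha> \<ge> 0"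
    using L[of 0 "axis undefined 1"] zero_le_dist order_trans by blast
  then have "L \<ge> 0" by simp
  have "G \<ge> 0" using G[of 0] norm_ge_zero order_trans by blast
  have K_cont: "continuous_on UNIV K"
    unfolding continuous_on_eq_continuous_at[OF open_UNIV] isCont_def
  proof
    fix x :: "real^'d"
    have "((\<lambda>y. dist y x) \<longlongrightarrow> 0) (at x)"
      using tendsto_dist_iff[of "\<lambda>y. y" x "at x"] by simp
    then have "((\<lambda>y. dist y x powr \<alpha>) \<longlongrightarrow> 0) (at x)"
      using \<alpha> by (intro tendsto_zero_powrI[where b = \<alpha>]) auto
    then have "((\<lambda>y. L * dist y x powr \<alpha>) \<longlongrightarrow> 0) (at x)"
      by (rule tendsto_mult_right_zero)
    then have "((\<lambda>y. K y - K x) \<longlongrightarrow> 0) (at x)"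
      by (rule Lim_null_comparison[rotated]) (use L in \<open>simp add: dist_real_def\<close>)
    then show "(K \<longlongrightarrow> K x) (at x)" by (rule LIM_zero_cancel)
  qed
  have f_cont: "continuous_on UNIV f"
    using \<open>\<And>x. GDERIV f x :> grad_f x\<close> unfolding gderiv_def
    by (intro continuous_at_imp_continuous_on ballI) (rule has_derivative_continuous)
  interpret kernel_density M X f K b
    using assms(2-4,7) b f_cont K_cont by unfold_locales (auto simp: abs_le_iff)
  have int2: "integrable lborel (\<lambda>z. (norm z)\<^sup>2 * K z)"
    using assms(7,19) by simp
  \<comment> \<open>\<open>\<kappa>\<close> is positive: if the square of \<open>K\<close> had
    integral 0, \<open>K\<close> would vanish almost everywhere, against its total mass 1.\<close>
  have "AE z in lborel. K z = 0" if "\<kappa> = 0"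
    using that integral_nonneg_eq_0_iff_AE[OF integrable_K_square[OF assms(16)]] assms(15) by simp
  then have "\<kappa> \<noteq> 0" using assms(17) by (metis integral_eq_zero_AE zero_neq_one)
  moreover have "\<kappa> \<ge> 0" unfolding assms(15) by (rule Bochner_Integration.integral_nonneg) simp
  ultimately have "\<kappa> > 0" by simp
  define c\<^sub>1 where "c\<^sub>1 = H * (\<integral>z. (norm z)\<^sup>2 * K z \<partial>lborel)"
  define c\<^sub>2 where "c\<^sub>2 = G * b * (\<integral>z. K z + (norm z)\<^sup>2 * K z \<partial>lborel)"
  have f_le: "f x \<le> B" for x using B[of x] by simp
  interpret confidence_band M X f K b \<kappa> B c\<^sub>1 c\<^sub>2 G L \<alpha> h hs v \<epsilon>
  proof
    show "\<bar>mollify K k x - f x\<bar> \<le> c\<^sub>1 * k\<^sup>2" for k x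
      unfolding c\<^sub>1_def by (rule bias_le[OF assms(22,23) H f_le assms(16,17) int2 assms(18)])
    show "\<bar>mollify (\<lambda>z. (K z)\<^sup>2) k x - f x * \<kappa>\<bar> \<le> c\<^sub>2 * k" if "k > 0" for k x
      unfolding c\<^sub>2_def assms(15) by (rule second_moment_le[OF assms(22) G f_le that assms(16) int2])
    show "c\<^sub>2 \<ge> 0"
      unfolding c\<^sub>2_def using \<open>G \<ge> 0\<close> b_nonneg K_nonneg
      by (intro mult_nonneg_nonneg Bochner_Integration.integral_nonneg) auto
    show "\<bar>K x - K y\<bar> \<le> L * dist x y powr \<alpha>" for x y :: "real^'d" using L[of x y] by (simp add: dist_real_def)
    show "\<bar>f x - f y\<bar> \<le> G * dist x y" for x y :: "real^'d"
      unfolding dist_norm by (rule GDERIV_bounded_imp_lipschitz[OF assms(22) G])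
  qed (use assms \<alpha> \<open>L \<ge> 0\<close> \<open>G \<ge> 0\<close> \<open>\<kappa> > 0\<close> f_le in auto)
  have width: "\<delta> * (sqrt (T n \<omega> x * \<kappa>) / v n) = width \<delta> n \<omega> x" for n \<omega> x
    by (simp add: width_def assms(36))
  have outside: "y \<notin> {a - w..a + w} \<longleftrightarrow> w < \<bar>y - a\<bar>" for y a w :: real
    by auto
  have miss: "{\<omega>\<in>space M. \<exists>x\<in>C. f x \<notin>
      {kde K (hs n) X n \<omega> x - \<delta> * (sqrt (T n \<omega> x * \<kappa>) / v n) ..
       kde K (hs n) X n \<omega> x + \<delta> * (sqrt (T n \<omega> x * \<kappa>) / v n)}} = miss C \<delta> n" for n
    unfolding miss_def width outside ..
  have "bounded C" using \<open>compact C\<close> by (rule compact_imp_bounded)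
  obtain x where x: "x \<in> C" "f x \<noteq> 0" using \<open>\<exists>x\<in>C. f x \<noteq> 0\<close> by blast
  then have "f x > 0" using f_nonneg[of x] by simp
  note lim = ln_prob_miss_lim[OF \<open>bounded C\<close> x(1) \<open>f x > 0\<close> \<open>\<delta> > 0\<close>]
  obtain \<Omega>\<^sub>0 where \<Omega>\<^sub>0: "\<Omega>\<^sub>0 \<subseteq> {\<omega> \<in> space M. \<forall>\<^sub>F n in sequentially. \<omega> \<in> space M - miss C \<delta> n}"
      "\<Omega>\<^sub>0 \<in> sets M" "prob \<Omega>\<^sub>0 = 1"
    by (rule AE_E_prob[OF AE_eventually_not_miss[OF \<open>bounded C\<close> \<open>\<delta> > 0\<close>]])
  have covered: "\<exists>n\<^sub>0. \<forall>n\<ge>n\<^sub>0. f \<in> {g. \<forall>x\<in>C. \<bar>g x - kde K (hs n) X n \<omega> x\<bar> \<le> width \<delta> n \<omega> x}"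
    if \<omega>: "\<omega> \<in> \<Omega>\<^sub>0" for \<omega>
  proof -
    obtain n\<^sub>0 where "\<And>n. n \<ge> n\<^sub>0 \<Longrightarrow> \<omega> \<in> space M - miss C \<delta> n"
      using \<Omega>\<^sub>0(1) \<omega> unfolding eventually_sequentially by blast
    then show ?thesis unfolding miss_def by (intro exI[of _ n\<^sub>0]) (auto simp: not_less)
  qed
  have "asymptotic_as_confidence_regions M
      (\<lambda>n \<omega>. {g. \<forall>x\<in>C. \<bar>g x - kde K (hs n) X n \<omega> x\<bar> \<le> \<delta> * (sqrt (T n \<omega> x * \<kappa>) / v n)}) f"
    unfolding asymptotic_as_confidence_regions_def width
    using \<Omega>\<^sub>0(2,3) covered by (intro bexI[of _ \<Omega>\<^sub>0] conjI ballI)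
  with lim show ?thesis unfolding miss by blast
qed

end
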